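(* Let $a,b\in{}^\bullet\mathbb{R}$ with ${}^\circ a<{}^\circ b$, let $f:[a,b]\to{}^\bullet\mathbb{R}$ be a smooth function, and let $u\in[a,b]$. Then there exists one and only one smooth function $I:[a,b]\to{}^\bullet\mathbb{R}$ such that $I'(x)=f(x)$ for all $x\in[a,b]$ and $I(u)=0$.
   Context: Fermat reals: let $\mathbb{R}_o[t]$ be the set of maps $x:\mathbb{R}_{\ge0}\to\mathbb{R}$, $t\mapsto x_t$, of the form $x_t=r+\sum_{i=1}^k\alpha_i t^{a_i}+o(t)$ as $t\to0^+$, with $k\in\mathbb{N}$, $r,\alpha_i\in\mathbb{R}$, $a_i\in\mathbb{R}_{\ge0}$. Write $x\sim y$ iff $x_t=y_t+o(t)$ as $t\to0^+$. The ring of Fermat reals is ${}^\bullet\mathbb{R}:=\mathbb{R}_o[t]/\sim$ with pointwise operations; $\mathbb{R}\subseteq{}^\bullet\mathbb{R}$ via constants. The standard part of $x=[x_t]$ is ${}^\circ x:=x_0$ (componentwise on ${}^\bullet\mathbb{R}^n$). ${}^\bullet\mathbb{R}$ is totally ordered by: $x\le y$ iff for representatives there is $z\in\mathbb{R}_o[t]$ with $z\sim0$ and $x_t\le y_t+z_t$ for all small $t\ge0$; $[a,b]:=\{x\in{}^\bullet\mathbb{R}:a\le x\le b\}$. The Fermat topology on ${}^\bullet\mathbb{R}^n$ has open sets ${}^\bullet V:=\{x:{}^\circ x\in V\}$, $V\subseteq\mathbb{R}^n$ open. For $\alpha\in C^\infty(W,\mathbb{R}^m)$, $W\subseteq\mathbb{R}^d$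 open, ${}^\bullet\alpha:{}^\bullet W\to{}^\bullet\mathbb{R}^m$, ${}^\bullet\alpha([x_t]):=[\alpha(x_t)]$. A map $f:S\to{}^\bullet\mathbb{R}^m$, $S\subseteq{}^\bullet\mathbb{R}^n$, is smooth (quasi-standard smooth) if for every $x\in S$ there exist open $V\subseteq\mathbb{R}^n$ with $x\in{}^\bullet V$, open $P\subseteq\mathbb{R}^{\mathsf p}$, $p\in{}^\bullet P$ and $\alpha\in C^\infty(P\times V,\mathbb{R}^m)$ with $f(y)={}^\bullet\alpha(p,y)$ for all $y\in{}^\bullet V\cap S$. For $f$ smooth on a non-infinitesimal interval $J$ (endpoints with distinct standard parts) and $x\in J$, the derivative is $f'(x):={}^\bullet(\partial_2\alpha)(p,x)$ for any such local representation of $f$ around $x$ (independent of the representation; equivalently $f'(x)=r(x,0)$ where $r$ is the unique smooth function with $f(x+h)=f(x)+h\,r(x,h)$ for all sufficiently small $h$ with $x+h\in J$). *)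

theory Defs
  imports "HOL-Analysis.Analysis"
begin

text \<open>Maps R_{>=0} -> R are represented by functions real => real; only their
values at t >= 0 (in fact near 0) matter.  "w = o(t) as t -> 0+" is read on
[0, delta) (this forces w 0 = 0, so the standard part is well defined).\<close>

definition littleo :: "(real \<Rightarrow> real) \<Rightarrow> bool" where
  "littleo w \<longleftrightarrow> (\<forall>e>0. \<exists>d>0. \<forall>t. 0 \<le> t \<and> t < d \<longrightarrow> \<bar>w t\<bar> \<le> e * t)"

definition tpow :: "real \<Rightarrow> real \<Rightarrow> real" where
  "tpow t a = (if a = 0 then 1 else t powr a)"

definition Ro :: "(real \<Rightarrow> real) set" where
  "Ro = {x. \<exists>r (k::nat) (\<alpha>::nat \<Rightarrow> real) (a::nat \<Rightarrow> real).
            (\<forall>i<k. 0 \<le> a i) \<and>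
            littleo (\<lambda>t. x t - (r + (\<Sum>i<k. \<alpha> i * tpow t (a i))))}"

definition ferm_rel :: "(real \<Rightarrow> real) \<Rightarrow> (real \<Rightarrow> real) \<Rightarrow> bool" where
  "ferm_rel x y \<longleftrightarrow> x \<in> Ro \<and> y \<in> Ro \<and> littleo (\<lambda>t. x t - y t)"

lemma littleo_zero: "littleo (\<lambda>t. 0)"
  unfolding littleo_def by (auto intro: exI[of _ 1])

lemma ferm_rel_part_equivp: "part_equivp ferm_rel"
proof (rule part_equivpI)
  have "(\<lambda>t. 0::real) \<in> Ro"
    unfolding Ro_def by (rule CollectI, rule exI[of _ 0], rule exI[of _ 0]) (simp add: littleo_zero)
  then show "\<exists>x. ferm_rel x x" unfolding ferm_rel_def by (auto simp: littleo_zero)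
  show "symp ferm_rel"
    unfolding symp_def ferm_rel_def littleo_def by (metis abs_minus_commute)
  show "transp ferm_rel"
  proof (rule transpI)
    fix x y z assume xy: "ferm_rel x y" and yz: "ferm_rel y z"
    have "littleo (\<lambda>t. x t - z t)"
      unfolding littleo_def
    proof (intro allI impI)
      fix e :: real assume e: "e > 0"
      obtain d1 where d1: "d1 > 0" "\<forall>t. 0 \<le> t \<and> t < d1 \<longrightarrow> \<bar>x t - y t\<bar> \<le> e/2 * t"
        using xy e unfolding ferm_rel_def littleo_def by (meson half_gt_zero)
      obtain d2 where d2: "d2 > 0" "\<forall>t. 0 \<le> t \<and> t < d2 \<longrightarrow> \<bar>y t - z t\<bar> \<le> e/2 * t"
        using yz e unfolding ferm_rel_def littleo_def by (meson half_gt_zero)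
      show "\<exists>d>0. \<forall>t. 0 \<le> t \<and> t < d \<longrightarrow> \<bar>x t - z t\<bar> \<le> e * t"
      proof (intro exI[of _ "min d1 d2"] conjI allI impI)
        show "min d1 d2 > 0" using d1 d2 by simp
        fix t assume t: "0 \<le> t \<and> t < min d1 d2"
        then have "\<bar>x t - y t\<bar> \<le> e/2 * t" "\<bar>y t - z t\<bar> \<le> e/2 * t" using d1 d2 by auto
        then show "\<bar>x t - z t\<bar> \<le> e * t" by linarith
      qed
    qed
    then show "ferm_rel x z" using xy yz unfolding ferm_rel_def by blast
  qed
qed

quotient_type fermat = "real \<Rightarrow> real" / partial: ferm_rel
  by (rule ferm_rel_part_equivp)

definition fconst :: "real \<Rightarrow> fermat" where
  "fconst r = abs_fermat (\<lambda>t. r)"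

definition st :: "fermat \<Rightarrow> real" where
  "st x = rep_fermat x 0"

definition fle :: "fermat \<Rightarrow> fermat \<Rightarrow> bool" where
  "fle x y \<longleftrightarrow> (\<exists>z. z \<in> Ro \<and> littleo z \<and>
       (\<exists>d>0. \<forall>t. 0 \<le> t \<and> t < d \<longrightarrow> rep_fermat x t \<le> rep_fermat y t + z t))"

definition fint :: "fermat \<Rightarrow> fermat \<Rightarrow> fermat set" where
  "fint a b = {x. fle a x \<and> fle x b}"

text \<open>R^k is represented by functions nat => real vanishing at indices >= k;
coordinates are 0..k-1.\<close>
definition rk :: "nat \<Rightarrow> (nat \<Rightarrow> real) set" where
  "rk k = {v. \<forall>i\<ge>k. v i = 0}"

definition open_k :: "nat \<Rightarrow> (nat \<Rightarrow> real) set \<Rightarrow> bool" where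
  "open_k k U \<longleftrightarrow> U \<subseteq> rk k \<and>
     (\<forall>u\<in>U. \<exists>e>0. \<forall>v\<in>rk k. (\<forall>i<k. \<bar>v i - u i\<bar> < e) \<longrightarrow> v \<in> U)"

definition cont_k :: "nat \<Rightarrow> (nat \<Rightarrow> real) set \<Rightarrow> ((nat \<Rightarrow> real) \<Rightarrow> real) \<Rightarrow> bool" where
  "cont_k k U g \<longleftrightarrow> (\<forall>u\<in>U. \<forall>e>0. \<exists>d>0. \<forall>v\<in>U.
       (\<forall>i<k. \<bar>v i - u i\<bar> < d) \<longrightarrow> \<bar>g v - g u\<bar> < e)"

definition pd :: "nat \<Rightarrow> ((nat \<Rightarrow> real) \<Rightarrow> real) \<Rightarrow> (nat \<Rightarrow> real) \<Rightarrow> real" where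
  "pd i g u = deriv (\<lambda>s. g (u(i := s))) (u i)"

primrec iter_pd :: "nat list \<Rightarrow> ((nat \<Rightarrow> real) \<Rightarrow> real) \<Rightarrow> (nat \<Rightarrow> real) \<Rightarrow> real" where
  "iter_pd [] g = g"
| "iter_pd (j # js) g = pd j (iter_pd js g)"

definition smooth_k :: "nat \<Rightarrow> (nat \<Rightarrow> real) set \<Rightarrow> ((nat \<Rightarrow> real) \<Rightarrow> real) \<Rightarrow> bool" where
  "smooth_k k U g \<longleftrightarrow> (\<forall>js. set js \<subseteq> {..<k} \<longrightarrow>
       cont_k k U (iter_pd js g) \<and>
       (\<forall>j<k. \<forall>u\<in>U. (\<lambda>s. iter_pd js g (u(j := s))) differentiable (at (u j))))"

definition prodset :: "nat \<Rightarrow> (nat \<Rightarrow> real) set \<Rightarrow> real set \<Rightarrow> (nat \<Rightarrow> real) set" where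
  "prodset p P V = {v \<in> rk (Suc p). (\<lambda>i. if i < p then v i else 0) \<in> P \<and> v p \<in> V}"

definition star_k :: "nat \<Rightarrow> (nat \<Rightarrow> real) set \<Rightarrow> (nat \<Rightarrow> fermat) set" where
  "star_k p P = {q. (\<lambda>i. if i < p then st (q i) else 0) \<in> P}"

definition ext :: "nat \<Rightarrow> ((nat \<Rightarrow> real) \<Rightarrow> real) \<Rightarrow> (nat \<Rightarrow> fermat) \<Rightarrow> fermat \<Rightarrow> fermat" where
  "ext p \<alpha> q y = abs_fermat (\<lambda>t. \<alpha> (\<lambda>i. if i < p then rep_fermat (q i) t
                                          else if i = p then rep_fermat y t else 0))"

definition local_rep :: "fermat set \<Rightarrow> (fermat \<Rightarrow> fermat) \<Rightarrow> fermat \<Rightarrow> nat \<Rightarrow>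
    (nat \<Rightarrow> real) set \<Rightarrow> real set \<Rightarrow> ((nat \<Rightarrow> real) \<Rightarrow> real) \<Rightarrow> (nat \<Rightarrow> fermat) \<Rightarrow> bool" where
  "local_rep S f x p P V \<alpha> q \<longleftrightarrow>
     open V \<and> st x \<in> V \<and> open_k p P \<and> q \<in> star_k p P \<and>
     smooth_k (Suc p) (prodset p P V) \<alpha> \<and>
     (\<forall>y\<in>S. st y \<in> V \<longrightarrow> f y = ext p \<alpha> q y)"

definition fsmooth :: "fermat set \<Rightarrow> (fermat \<Rightarrow> fermat) \<Rightarrow> bool" where
  "fsmooth S f \<longleftrightarrow> (\<forall>x\<in>S. \<exists>p P V \<alpha> q. local_rep S f x p P V \<alpha> q)"

text \<open>Derivative f'(x) = ext(d_2 alpha)(q, x) for a (any) local representation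
around x; the differentiation is with respect to the last coordinate p.\<close>
definition fderiv :: "fermat set \<Rightarrow> (fermat \<Rightarrow> fermat) \<Rightarrow> fermat \<Rightarrow> fermat" where
  "fderiv S f x = (SOME d. \<exists>p P V \<alpha> q. local_rep S f x p P V \<alpha> q \<and> d = ext p (pd p \<alpha>) q x)"

end

theory Submission
  imports Defs
begin

text \<open>Along the curves representing the parameters of a local representation \<open>\<alpha>(q, s)\<close>, Taylor's formula in one
parameter after another gives a normal form \<open>\<alpha>(q\<^sub>t, s) = \<Sum>e\<in>E. t^e * \<psi>\<^sub>e(s) + o(t)\<close>, uniformly for \<open>s\<close> in a ball,
with a finite set \<open>E\<close> of exponents in \<open>[0, 1]\<close> and smooth functions \<open>\<psi>\<^sub>e\<close> of one real variable. The
coefficients are determined by the values of the function at standard points, so differentiation acts on each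
\<open>\<psi>\<^sub>e\<close> separately, and the local normal forms of a smooth function on \<open>[a, b]\<close> glue to one global normal form.
Existence and uniqueness of primitives thereby reduce to the real case. The points infinitely close to \<open>a\<close> or \<open>b\<close>
need extra care, because their representatives may leave the real interval: a smooth function
that vanishes on the open interval is flat at its endpoints, hence \<open>o(t)\<close> along any such representative.\<close>

text \<open>Integrating a local representation in its last variable gives a local primitive, but
  neighbouring representations have unrelated parameter spaces and unrelated
  \<open>\<alpha>\<close>, so these primitives cannot simply be patched together. In normal form the
  parameters are always the same powers \<open>t^e\<close>, and patching becomes patching of real
  functions, exponent by exponent. Two facts keep the form finite: a curve in \<open>Ro\<close>
  minus its standard part has a power that is \<open>o(t)\<close>, so Taylor sums in the parameters
  stop; and \<open>t^e\<close> with \<open>e > 1\<close> is itself \<open>o(t)\<close>, so exponents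
  stop at 1. The variable \<open>s\<close> is not expanded: the coefficients remain functions of it,
  and uniformity in \<open>s\<close> allows a moving curve to be put in its place. The derivative is
  a \<open>SOME\<close> over all local representations, so its value is accessible only once all of
  them are shown to agree; the rigidity of the coefficients gives this too. Since \<open>u\<close>
  need not be standard, the value of a primitive at \<open>u\<close> need not be a real number; the
  constant of integration consists of one real number for each exponent.\<close>

section \<open>Little-o calculus at zero, uniform in a parameter\<close>

definition near0 :: "real filter" where
  "near0 = inf (nhds 0) (principal {0..})"

lemma eventually_near0:
  "eventually P near0 \<longleftrightarrow> (\<exists>d>0. \<forall>t. 0 \<le> t \<and> t < d \<longrightarrow> P t)"
proof -
  have "eventually P near0 \<longleftrightarrow> (\<exists>d>0. \<forall>t. \<bar>t\<bar> < d \<longrightarrow> 0 \<le> t \<longrightarrow> P t)"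
    unfolding near0_def eventually_inf_principal eventually_nhds_metric by (simp add: dist_real_def)
  then show ?thesis
    by (metis abs_of_nonneg)
qed

text \<open>The generating intervals [0, d) contain 0, unlike those of \<open>at_right 0\<close>.
  This is how a little-o bound forces the value 0 at \<open>t = 0\<close> and thereby fixes standard
  parts.\<close>

lemma eventually_near0_at_0: "eventually P near0 \<Longrightarrow> P 0"
  by (auto simp: eventually_near0)

lemma eventually_near0_nonneg: "\<forall>\<^sub>F t in near0. 0 \<le> t"
  and eventually_near0_less: "0 < d \<Longrightarrow> \<forall>\<^sub>F t in near0. t < d"
  unfolding eventually_near0 by (auto intro: exI[of _ 1])

lemma eventually_near0_at_right: "eventually P near0 \<Longrightarrow> eventually P (at_right 0)"
  by (auto simp: eventually_near0 eventually_at_right_field)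

lemma littleo_iff: "littleo w \<longleftrightarrow> (\<forall>e>0. \<forall>\<^sub>F t in near0. \<bar>w t\<bar> \<le> e * t)"
  by (simp add: littleo_def eventually_near0)

text \<open>Uniformity over \<open>B\<close> serves two ends: a curve running inside
  \<open>B\<close> may be substituted for \<open>s\<close>, and a bound on a derivative in
  \<open>s\<close> can be fed to the mean value theorem.\<close>

definition unif_littleo :: "'a set \<Rightarrow> (real \<Rightarrow> 'a \<Rightarrow> real) \<Rightarrow> bool" where
  "unif_littleo B w \<longleftrightarrow> (\<forall>e>0. \<forall>\<^sub>F t in near0. \<forall>s\<in>B. \<bar>w t s\<bar> \<le> e * t)"

definition unif_bounded :: "'a set \<Rightarrow> (real \<Rightarrow> 'a \<Rightarrow> real) \<Rightarrow> bool" where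
  "unif_bounded B w \<longleftrightarrow> (\<exists>M. \<forall>\<^sub>F t in near0. \<forall>s\<in>B. \<bar>w t s\<bar> \<le> M)"

text \<open>A one-point parameter space turns the uniform notion into the plain one, so each
  calculus rule is proved only once.\<close>

lemma littleo_unit: "littleo w \<longleftrightarrow> unif_littleo UNIV (\<lambda>t (_::unit). w t)"
  by (simp add: littleo_iff unif_littleo_def)

lemma unif_littleo_const: "littleo w \<Longrightarrow> unif_littleo B (\<lambda>t s. w t)"
  unfolding littleo_iff unif_littleo_def by (auto elim!: eventually_mono)

lemma unif_littleo_zero [simp]: "unif_littleo B (\<lambda>t s. 0)"
  unfolding unif_littleo_def using eventually_near0_nonneg by (auto elim!: eventually_mono)

lemma unif_littleo_add:
  assumes "unif_littleo B v" "unif_littleo B w"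
  shows "unif_littleo B (\<lambda>t s. v t s + w t s)"
  unfolding unif_littleo_def
proof (intro allI impI)
  fix e :: real assume "e > 0"
  then have "\<forall>\<^sub>F t in near0. \<forall>s\<in>B. \<bar>v t s\<bar> \<le> e/2 * t" "\<forall>\<^sub>F t in near0. \<forall>s\<in>B. \<bar>w t s\<bar> \<le> e/2 * t"
    using assms unfolding unif_littleo_def by (meson half_gt_zero)+
  then show "\<forall>\<^sub>F t in near0. \<forall>s\<in>B. \<bar>v t s + w t s\<bar> \<le> e * t"
  proof eventually_elim
    case (elim t)
    show ?case
    proof
      fix s assume "s \<in> B"
      then have "\<bar>v t s\<bar> \<le> e/2 * t" "\<bar>w t s\<bar> \<le> e/2 * t" using elim by auto
      then show "\<bar>v t s + w t s\<bar> \<le> e * t" by linarith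
    qed
  qed
qed

lemma unif_littleo_minus: "unif_littleo B w \<Longrightarrow> unif_littleo B (\<lambda>t s. - w t s)"
  unfolding unif_littleo_def by simp

lemma unif_littleo_diff:
  "unif_littleo B v \<Longrightarrow> unif_littleo B w \<Longrightarrow> unif_littleo B (\<lambda>t s. v t s - w t s)"
  using unif_littleo_add[of B v "\<lambda>t s. - w t s"] by (simp add: unif_littleo_minus)

lemma unif_littleo_mono:
  assumes "unif_littleo B v" "\<forall>\<^sub>F t in near0. \<forall>s\<in>B. \<bar>w t s\<bar> \<le> M * \<bar>v t s\<bar>"
  shows "unif_littleo B w"
  unfolding unif_littleo_def
proof (intro allI impI)
  fix e :: real assume "e > 0"
  \<comment> \<open>\<open>M\<close> may be zero or negative; this upper bound of it is positive, so
    \<open>e\<close> can be divided by it.\<close>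
  define K where "K = \<bar>M\<bar> + 1"
  have K: "K > 0" "M \<le> K" by (auto simp: K_def)
  have "\<forall>\<^sub>F t in near0. \<forall>s\<in>B. \<bar>v t s\<bar> \<le> e / K * t"
    using assms(1) divide_pos_pos[OF \<open>e > 0\<close> K(1)] unfolding unif_littleo_def by blast
  with assms(2) show "\<forall>\<^sub>F t in near0. \<forall>s\<in>B. \<bar>w t s\<bar> \<le> e * t"
  proof eventually_elim
    case (elim t)
    show ?case
    proof
      fix s assume "s \<in> B"
      then have "\<bar>w t s\<bar> \<le> M * \<bar>v t s\<bar>" "\<bar>v t s\<bar> \<le> e / K * t" using elim by auto
      moreover have "M * \<bar>v t s\<bar> \<le> K * \<bar>v t s\<bar>" using K by (intro mult_right_mono) auto
      moreover have "K * \<bar>v t s\<bar> \<le> K * (e / K * t)" using calculation K by (intro mult_left_mono) auto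
      ultimately show "\<bar>w t s\<bar> \<le> e * t" using K by simp
    qed
  qed
qed

lemma unif_littleo_mult:
  assumes "unif_littleo B v" "unif_bounded B w"
  shows "unif_littleo B (\<lambda>t s. v t s * w t s)"
proof -
  obtain M where "\<forall>\<^sub>F t in near0. \<forall>s\<in>B. \<bar>w t s\<bar> \<le> M"
    using assms(2) by (auto simp: unif_bounded_def)
  then have "\<forall>\<^sub>F t in near0. \<forall>s\<in>B. \<bar>v t s * w t s\<bar> \<le> M * \<bar>v t s\<bar>"
    by (rule eventually_mono) (metis abs_ge_zero abs_mult mult.commute mult_right_mono)
  then show ?thesis using assms(1) by (rule unif_littleo_mono[rotated])
qed

lemma unif_littleo_sum:
  "(\<And>i. i \<in> I \<Longrightarrow> unif_littleo B (w i)) \<Longrightarrow> unif_littleo B (\<lambda>t s. \<Sum>i\<in>I. w i t s)"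
  by (induction I rule: infinite_finite_induct) (auto intro: unif_littleo_add)

lemma unif_bounded_add:
  assumes "unif_bounded B v" "unif_bounded B w"
  shows "unif_bounded B (\<lambda>t s. v t s + w t s)"
proof -
  obtain M N where "\<forall>\<^sub>F t in near0. \<forall>s\<in>B. \<bar>v t s\<bar> \<le> M" "\<forall>\<^sub>F t in near0. \<forall>s\<in>B. \<bar>w t s\<bar> \<le> N"
    using assms by (auto simp: unif_bounded_def)
  then have "\<forall>\<^sub>F t in near0. \<forall>s\<in>B. \<bar>v t s + w t s\<bar> \<le> M + N"
    by eventually_elim (meson abs_triangle_ineq add_mono order_trans)
  then show ?thesis unfolding unif_bounded_def by blast
qed

lemma unif_littleo_imp_bounded:
  assumes "unif_littleo B w"
  shows "unif_bounded B w"
proof -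
  have "\<forall>\<^sub>F t in near0. \<forall>s\<in>B. \<bar>w t s\<bar> \<le> 1 * t"
    using assms unfolding unif_littleo_def by (meson zero_less_one)
  with eventually_near0_less[OF zero_less_one] have "\<forall>\<^sub>F t in near0. \<forall>s\<in>B. \<bar>w t s\<bar> \<le> 1"
    by eventually_elim force
  then show ?thesis unfolding unif_bounded_def by blast
qed

lemma unif_littleo_curve:
  assumes "unif_littleo B w" "\<forall>\<^sub>F t in near0. y t \<in> B"
  shows "littleo (\<lambda>t. w t (y t))"
  unfolding littleo_iff
proof (intro allI impI)
  fix e :: real assume "e > 0"
  then have "\<forall>\<^sub>F t in near0. \<forall>s\<in>B. \<bar>w t s\<bar> \<le> e * t"
    using assms(1) unfolding unif_littleo_def by blast
  with assms(2) show "\<forall>\<^sub>F t in near0. \<bar>w t (y t)\<bar> \<le> e * t"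
    by eventually_elim auto
qed

lemma littleo_add: "littleo v \<Longrightarrow> littleo w \<Longrightarrow> littleo (\<lambda>t. v t + w t)"
  and littleo_diff: "littleo v \<Longrightarrow> littleo w \<Longrightarrow> littleo (\<lambda>t. v t - w t)"
  and littleo_sum: "(\<And>i. i \<in> I \<Longrightarrow> littleo (z i)) \<Longrightarrow> littleo (\<lambda>t. \<Sum>i\<in>I. z i t)"
  and littleo_mult: "littleo v \<Longrightarrow> unif_bounded (UNIV::unit set) (\<lambda>t _. w t) \<Longrightarrow> littleo (\<lambda>t. v t * w t)"
  and littleo_mono: "littleo v \<Longrightarrow> \<forall>\<^sub>F t in near0. \<bar>w t\<bar> \<le> M * \<bar>v t\<bar> \<Longrightarrow> littleo w"
  unfolding littleo_unit
  by (auto intro: unif_littleo_add unif_littleo_diff unif_littleo_sum unif_littleo_mult unif_littleo_mono)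

lemma littleo_at_0: "littleo w \<Longrightarrow> w 0 = 0"
  unfolding littleo_iff by (metis abs_le_zero_iff eventually_near0_at_0 mult_zero_right zero_less_one)

text \<open>This is why normal forms need only exponents in [0, 1]: every higher power is zero in
  the ring.\<close>

lemma littleo_powr:
  assumes "1 < e" shows "littleo (\<lambda>t. t powr e)"
  unfolding littleo_iff
proof (intro allI impI)
  fix \<epsilon> :: real assume "\<epsilon> > 0"
  \<comment> \<open>Solves \<open>d powr (e - 1) = \<epsilon>\<close>, so that one factor
    \<open>t\<close> can be split off and the rest is at most \<open>\<epsilon>\<close>.\<close>
  define d where "d = \<epsilon> powr (1 / (e - 1))"
  have d: "d > 0" using \<open>\<epsilon> > 0\<close> by (simp add: d_def)
  show "\<forall>\<^sub>F t in near0. \<bar>t powr e\<bar> \<le> \<epsilon> * t"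
    using eventually_near0_less[OF d] eventually_near0_nonneg
  proof eventually_elim
    case (elim t)
    show ?case
    proof (cases "t = 0")
      case False
      then have t: "t > 0" using elim by simp
      have "t powr (e - 1) \<le> d powr (e - 1)" using elim assms by (intro powr_mono2) auto
      also have "\<dots> = \<epsilon>" using assms \<open>\<epsilon> > 0\<close> by (simp add: d_def powr_powr)
      finally have "t powr (e - 1) * t \<le> \<epsilon> * t" using t by (intro mult_right_mono) auto
      moreover have "t powr e = t powr (e - 1) * t"
        using t powr_add[of t "e - 1" 1] by simp
      ultimately show ?thesis by (metis abs_of_nonneg powr_ge_zero)
    qed simp
  qed
qed

section \<open>Powers of the infinitesimal parameter\<close>

lemma tpow_add: "0 \<le> a \<Longrightarrow> 0 \<le> b \<Longrightarrow> tpow t (a + b) = tpow t a * tpow t b"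
  by (auto simp: tpow_def powr_add)

lemma tpow_le_1: "0 \<le> t \<Longrightarrow> t \<le> 1 \<Longrightarrow> 0 \<le> a \<Longrightarrow> \<bar>tpow t a\<bar> \<le> 1"
  by (auto simp: tpow_def powr_le1)

lemma unif_bounded_tpow: 
  assumes "0 \<le> a" shows "unif_bounded B (\<lambda>t s. tpow t a)"
proof -
  have "\<forall>\<^sub>F t in near0. \<forall>s\<in>B. \<bar>tpow t a\<bar> \<le> 1"
    using eventually_near0_nonneg eventually_near0_less[OF zero_less_one]
    by eventually_elim (simp add: tpow_le_1 assms)
  then show ?thesis unfolding unif_bounded_def by blast
qed

text \<open>Dividing by the lowest power with a nonzero coefficient isolates that coefficient in the limit.\<close>
lemma tpow_sum_littleoD:
  assumes E: "finite E" "E \<subseteq> {0..1}" and o: "littleo (\<lambda>t. \<Sum>e\<in>E. tpow t e * c e)"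
  shows "\<forall>e\<in>E. c e = 0"
proof (rule ccontr)
  assume neg: "\<not> (\<forall>e\<in>E. c e = 0)"
  define N where "N = {e\<in>E. c e \<noteq> 0}"
  have N: "finite N" "N \<noteq> {}" using E neg by (auto simp: N_def)
  define m where "m = Min N"
  have m: "m \<in> N" "\<And>e. e \<in> N \<Longrightarrow> m \<le> e" using N by (auto simp: m_def)
  then have m01: "0 \<le> m" "m \<le> 1" "c m \<noteq> 0" using E by (auto simp: N_def)
  have "((\<lambda>t. \<Sum>e\<in>N. (if e = m then 1 else t powr (e - m)) * c e) \<longlongrightarrow> (\<Sum>e\<in>N. (if e = m then 1 else 0) * c e)) (at_right 0)"
  proof (intro tendsto_intros)
    fix e assume e: "e \<in> N"
    show "((\<lambda>t. if e = m then 1 else t powr (e - m)) \<longlongrightarrow> (if e = m then 1 else 0)) (at_right (0::real))"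
    proof (cases "e = m")
      case False
      then have "e - m > 0" using m(2)[OF e] by simp
      then have "((\<lambda>t. t powr (e - m)) \<longlongrightarrow> 0 powr (e - m)) (at_right (0::real))"
        by (intro tendsto_powr2 tendsto_intros) (auto simp: eventually_at_right_field intro: exI[of _ 1])
      then show ?thesis using False by simp
    qed auto
  qed
  also have "(\<Sum>e\<in>N. (if e = m then 1 else 0) * c e) = c m"
    using N m by (simp add: if_distrib[of "\<lambda>x. x * _"] cong: if_cong)
  finally have lim: "((\<lambda>t. \<bar>\<Sum>e\<in>N. (if e = m then 1 else t powr (e - m)) * c e\<bar>) \<longlongrightarrow> \<bar>c m\<bar>) (at_right 0)"
    by (rule tendsto_rabs)
  have "\<bar>c m\<bar> \<le> \<bar>c m\<bar> / 2"
  proof (rule tendsto_upperbound[OF lim])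
    have "\<forall>\<^sub>F t in near0. \<bar>\<Sum>e\<in>E. tpow t e * c e\<bar> \<le> \<bar>c m\<bar> / 2 * t"
      using o m01 unfolding littleo_iff by (metis half_gt_zero zero_less_abs_iff)
    then have "\<forall>\<^sub>F t in at_right 0. \<bar>\<Sum>e\<in>E. tpow t e * c e\<bar> \<le> \<bar>c m\<bar> / 2 * t"
      by (rule eventually_near0_at_right)
    moreover have "\<forall>\<^sub>F t in at_right 0. (0::real) < t"
      by (auto simp: eventually_at_right_field intro: exI[of _ 1])
    moreover have "\<forall>\<^sub>F t in at_right 0. t < (1::real)"
      by (auto simp: eventually_at_right_field intro: exI[of _ 1])
    ultimately show "\<forall>\<^sub>F t in at_right 0. \<bar>\<Sum>e\<in>N. (if e = m then 1 else t powr (e - m)) * c e\<bar> \<le> \<bar>c m\<bar> / 2"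
    proof eventually_elim
      case (elim t)
      have "(\<Sum>e\<in>E. tpow t e * c e) = (\<Sum>e\<in>N. tpow t e * c e)"
        using E by (intro sum.mono_neutral_right) (auto simp: N_def)
      also have "\<dots> = (\<Sum>e\<in>N. t powr m * ((if e = m then 1 else t powr (e - m)) * c e))"
      proof (rule sum.cong[OF refl])
        fix e assume "e \<in> N"
        have "tpow t e = t powr m * (if e = m then 1 else t powr (e - m))"
          using elim powr_add[of t m "e - m"] by (auto simp: tpow_def)
        then show "tpow t e * c e = t powr m * ((if e = m then 1 else t powr (e - m)) * c e)" by simp
      qed
      finally have "(\<Sum>e\<in>E. tpow t e * c e) = t powr m * (\<Sum>e\<in>N. (if e = m then 1 else t powr (e - m)) * c e)"
        by (simp add: sum_distrib_left)
      then have "t powr m * \<bar>\<Sum>e\<in>N. (if e = m then 1 else t powr (e - m)) * c e\<bar> \<le> \<bar>c m\<bar> / 2 * t"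
        using elim by (simp add: abs_mult)
      \<comment> \<open>Here the bound 1 on the exponents enters: since \<open>m \<le> 1\<close>, an
        \<open>o(t)\<close> remainder stays negligible after division by
        \<open>t powr m\<close>.\<close>
      also have "t \<le> t powr m" using elim m01 powr_mono'[of m 1 t] by simp
      then have "\<bar>c m\<bar> / 2 * t \<le> t powr m * (\<bar>c m\<bar> / 2)"
        using mult_right_mono[of t "t powr m" "\<bar>c m\<bar> / 2"] by (simp only: mult.commute)
      finally show ?case using elim by (simp only: mult_le_cancel_left_pos powr_gt_zero)
    qed
  qed auto
  then show False using m01 by simp
qed

section \<open>Finite expansions with coefficient functions\<close>

text \<open>Constants as coefficients give little-oh polynomials; smooth functions of
  \<open>s\<close> give families of them. Exponents are unbounded here so that products stay inside;
  they are cut off at 1 only in the normal form.\<close>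

inductive_set gexp :: "('a \<Rightarrow> real) set \<Rightarrow> (real \<Rightarrow> 'a \<Rightarrow> real) set" for A where
  gexp_monom: "0 \<le> e \<Longrightarrow> \<phi> \<in> A \<Longrightarrow> (\<lambda>t s. tpow t e * \<phi> s) \<in> gexp A"
| gexp_add: "v \<in> gexp A \<Longrightarrow> w \<in> gexp A \<Longrightarrow> (\<lambda>t s. v t s + w t s) \<in> gexp A"

abbreviation const_funs :: "('a \<Rightarrow> real) set" where
  "const_funs \<equiv> range (\<lambda>c s. c)"

text \<open>A vector space suffices, because a product always has one factor with constant
  coefficients: Taylor coefficients carry the dependence on \<open>s\<close>, powers of the
  parameter increments do not. Boundedness on \<open>B\<close> makes \<open>t^e * \<phi> s\<close>
  with \<open>e > 1\<close> uniformly \<open>o(t)\<close>.\<close>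

locale coeff_space =
  fixes A :: "('a \<Rightarrow> real) set" and B :: "'a set"
  assumes zero_mem: "(\<lambda>s. 0) \<in> A"
    and add_mem: "\<phi> \<in> A \<Longrightarrow> \<psi> \<in> A \<Longrightarrow> (\<lambda>s. \<phi> s + \<psi> s) \<in> A"
    and scale_mem: "\<phi> \<in> A \<Longrightarrow> (\<lambda>s. \<phi> s * c) \<in> A"
    and bounded_mem: "\<phi> \<in> A \<Longrightarrow> \<exists>M. \<forall>s\<in>B. \<bar>\<phi> s\<bar> \<le> M"
begin

lemma gexp_bounded: "w \<in> gexp A \<Longrightarrow> unif_bounded B w"
proof (induction rule: gexp.induct)
  case (gexp_monom e \<phi>)
  obtain M where M: "\<forall>s\<in>B. \<bar>\<phi> s\<bar> \<le> M" using bounded_mem gexp_monom by blast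
  have "\<forall>\<^sub>F t in near0. \<forall>s\<in>B. \<bar>tpow t e * \<phi> s\<bar> \<le> M"
    using eventually_near0_nonneg eventually_near0_less[OF zero_less_one]
  proof eventually_elim
    case (elim t)
    show ?case
    proof
      fix s assume "s \<in> B"
      then have "\<bar>tpow t e\<bar> * \<bar>\<phi> s\<bar> \<le> 1 * M"
        using tpow_le_1[of t e] elim M gexp_monom(1) by (intro mult_mono) simp_all
      then show "\<bar>tpow t e * \<phi> s\<bar> \<le> M" by (simp add: abs_mult)
    qed
  qed
  then show ?case unfolding unif_bounded_def by blast
qed (rule unif_bounded_add)

lemma gexp_mult:
  assumes "w \<in> gexp A" "v \<in> gexp const_funs"
  shows "(\<lambda>t s. w t s * v t s) \<in> gexp A"
  using assms(2)
proof (induction rule: gexp.induct)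
  case (gexp_monom a \<phi>)
  then obtain c where \<phi>: "\<phi> = (\<lambda>s. c)" by auto
  from assms(1) show ?case
  proof (induction rule: gexp.induct)
    case (gexp_monom e \<psi>)
    have "(\<lambda>t s. tpow t (e + a) * (\<psi> s * c)) \<in> gexp A"
      using gexp_monom \<open>0 \<le> a\<close> by (intro gexp.gexp_monom scale_mem) auto
    then show ?case
      using gexp_monom \<open>0 \<le> a\<close> by (simp add: tpow_add \<phi> mult_ac)
  next
    case (gexp_add v w)
    then show ?case using gexp.gexp_add[OF gexp_add.IH] by (simp add: distrib_right)
  qed
next
  case (gexp_add v w)
  then show ?case using gexp.gexp_add[OF gexp_add.IH] by (simp add: distrib_left)
qed

text \<open>Coefficient families are extended by zero outside \<open>E\<close>, so that \<open>E\<close> can be enlarged freely.\<close>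
lemma gexp_normal_form:
  assumes "w \<in> gexp A"
  shows "\<exists>E \<psi>. finite E \<and> E \<subseteq> {0..1} \<and> (\<forall>e. \<psi> e \<in> A) \<and> (\<forall>e. e \<notin> E \<longrightarrow> \<psi> e = (\<lambda>_. 0)) \<and>
           unif_littleo B (\<lambda>t s. w t s - (\<Sum>e\<in>E. tpow t e * \<psi> e s))"
  using assms
proof (induction rule: gexp.induct)
  case (gexp_monom e \<phi>)
  show ?case
  proof (cases "e \<le> 1")
    case True
    then show ?thesis using gexp_monom zero_mem
      by (intro exI[of _ "{e}"] exI[of _ "\<lambda>x. if x = e then \<phi> else (\<lambda>_. 0)"]) auto
  next
    case False
    obtain M where M: "\<forall>s\<in>B. \<bar>\<phi> s\<bar> \<le> M" using bounded_mem gexp_monom by blast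
    then have "unif_bounded B (\<lambda>t s. \<phi> s)" unfolding unif_bounded_def by (intro exI[of _ M]) simp
    moreover have "unif_littleo B (\<lambda>t s. t powr e)"
      using False by (intro unif_littleo_const littleo_powr) simp
    ultimately have "unif_littleo B (\<lambda>t s. t powr e * \<phi> s)" by (rule unif_littleo_mult[rotated])
    then show ?thesis using False zero_mem
      by (intro exI[of _ "{}"] exI[of _ "\<lambda>x _. 0"]) (auto simp: tpow_def)
  qed
next
  case (gexp_add v w)
  obtain E \<psi> F \<theta> where
    E: "finite E" "E \<subseteq> {0..1}" "\<forall>e. \<psi> e \<in> A" "\<forall>e. e \<notin> E \<longrightarrow> \<psi> e = (\<lambda>_. 0)"
      "unif_littleo B (\<lambda>t s. v t s - (\<Sum>e\<in>E. tpow t e * \<psi> e s))" and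
    F: "finite F" "F \<subseteq> {0..1}" "\<forall>e. \<theta> e \<in> A" "\<forall>e. e \<notin> F \<longrightarrow> \<theta> e = (\<lambda>_. 0)"
      "unif_littleo B (\<lambda>t s. w t s - (\<Sum>e\<in>F. tpow t e * \<theta> e s))"
    using gexp_add.IH by blast
  have "(\<Sum>e\<in>E. tpow t e * \<psi> e s) = (\<Sum>e\<in>E\<union>F. tpow t e * \<psi> e s)" for t s
    using E F by (intro sum.mono_neutral_left) auto
  moreover have "(\<Sum>e\<in>F. tpow t e * \<theta> e s) = (\<Sum>e\<in>E\<union>F. tpow t e * \<theta> e s)" for t s
    using E F by (intro sum.mono_neutral_left) auto
  ultimately have "(\<lambda>t s. (v t s - (\<Sum>e\<in>E. tpow t e * \<psi> e s)) + (w t s - (\<Sum>e\<in>F. tpow t e * \<theta> e s))) =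
      (\<lambda>t s. v t s + w t s - (\<Sum>e\<in>E\<union>F. tpow t e * (\<psi> e s + \<theta> e s)))"
    by (simp add: fun_eq_iff distrib_left sum.distrib)
  then have "unif_littleo B (\<lambda>t s. v t s + w t s - (\<Sum>e\<in>E\<union>F. tpow t e * (\<psi> e s + \<theta> e s)))"
    using unif_littleo_add[OF E(5) F(5)] by simp
  then show ?case
    using E F by (intro exI[of _ "E \<union> F"] exI[of _ "\<lambda>e s. \<psi> e s + \<theta> e s"]) (auto intro: add_mem)
qed

end

definition has_exp :: "('a \<Rightarrow> real) set \<Rightarrow> 'a set \<Rightarrow> (real \<Rightarrow> 'a \<Rightarrow> real) \<Rightarrow> bool" where
  "has_exp A B w \<longleftrightarrow> (\<exists>g\<in>gexp A. unif_littleo B (\<lambda>t s. w t s - g t s))"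

lemma has_exp_add:
  assumes "has_exp A B v" "has_exp A B w" shows "has_exp A B (\<lambda>t s. v t s + w t s)"
proof -
  obtain g h where gh: "g \<in> gexp A" "unif_littleo B (\<lambda>t s. v t s - g t s)"
    "h \<in> gexp A" "unif_littleo B (\<lambda>t s. w t s - h t s)"
    using assms by (auto simp: has_exp_def)
  have "unif_littleo B (\<lambda>t s. (v t s + w t s) - (g t s + h t s))"
    using unif_littleo_add[OF gh(2,4)] by (simp add: algebra_simps)
  then show ?thesis unfolding has_exp_def using gexp_add[OF gh(1,3)] by (intro bexI[of _ "\<lambda>t s. g t s + h t s"])
qed

lemma has_exp_perturb:
  assumes "has_exp A B v" "unif_littleo B (\<lambda>t s. w t s - v t s)" shows "has_exp A B w"
proof -
  obtain g where g: "g \<in> gexp A" "unif_littleo B (\<lambda>t s. v t s - g t s)"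
    using assms by (auto simp: has_exp_def)
  have "unif_littleo B (\<lambda>t s. w t s - g t s)"
    using unif_littleo_add[OF assms(2) g(2)] by simp
  then show ?thesis unfolding has_exp_def using g by blast
qed

lemma has_exp_coeff:
  assumes "\<phi> \<in> A" shows "has_exp A B (\<lambda>t s. \<phi> s)"
  using gexp_monom[of 0, OF _ assms] by (auto simp: has_exp_def tpow_def intro!: bexI[of _ "\<lambda>t s. \<phi> s"])

interpretation const_coeff: coeff_space "const_funs :: ('a \<Rightarrow> real) set" B
  by standard auto

context coeff_space
begin

lemma has_exp_zero: "has_exp A B (\<lambda>t s. 0)"
  using has_exp_coeff[OF zero_mem] by simp

lemma has_exp_sum:
  "(\<And>i. i \<in> I \<Longrightarrow> has_exp A B (w i)) \<Longrightarrow> has_exp A B (\<lambda>t s. \<Sum>i\<in>I. w i t s)"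
  by (induction I rule: infinite_finite_induct) (auto intro: has_exp_add has_exp_zero)

lemma has_exp_bounded:
  assumes "has_exp A B w" shows "unif_bounded B w"
proof -
  obtain g where g: "g \<in> gexp A" "unif_littleo B (\<lambda>t s. w t s - g t s)"
    using assms by (auto simp: has_exp_def)
  have "unif_bounded B (\<lambda>t s. (w t s - g t s) + g t s)"
    by (intro unif_bounded_add unif_littleo_imp_bounded g gexp_bounded)
  then show ?thesis by simp
qed

lemma has_exp_mult:
  assumes "has_exp A B w" "has_exp const_funs B v"
  shows "has_exp A B (\<lambda>t s. w t s * v t s)"
proof -
  obtain g h where gh: "g \<in> gexp A" "unif_littleo B (\<lambda>t s. w t s - g t s)"
    "h \<in> gexp const_funs" "unif_littleo B (\<lambda>t s. v t s - h t s)"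
    using assms by (auto simp: has_exp_def)
  have "unif_littleo B (\<lambda>t s. (w t s - g t s) * v t s + (v t s - h t s) * g t s)"
    using gh assms by (intro unif_littleo_add unif_littleo_mult const_coeff.has_exp_bounded gexp_bounded)
  then have "unif_littleo B (\<lambda>t s. w t s * v t s - g t s * h t s)"
    by (simp add: algebra_simps)
  then show ?thesis unfolding has_exp_def using gexp_mult[OF gh(1,3)] by (intro bexI[of _ "\<lambda>t s. g t s * h t s"])
qed

lemma has_exp_normal_form:
  assumes "has_exp A B w"
  shows "\<exists>E \<psi>. finite E \<and> E \<subseteq> {0..1} \<and> (\<forall>e. \<psi> e \<in> A) \<and> (\<forall>e. e \<notin> E \<longrightarrow> \<psi> e = (\<lambda>_. 0)) \<and>
           unif_littleo B (\<lambda>t s. w t s - (\<Sum>e\<in>E. tpow t e * \<psi> e s))"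
proof -
  obtain g where g: "g \<in> gexp A" "unif_littleo B (\<lambda>t s. w t s - g t s)"
    using assms by (auto simp: has_exp_def)
  obtain E \<psi> where E: "finite E" "E \<subseteq> {0..1}" "\<forall>e. \<psi> e \<in> A" "\<forall>e. e \<notin> E \<longrightarrow> \<psi> e = (\<lambda>_. 0)"
      "unif_littleo B (\<lambda>t s. g t s - (\<Sum>e\<in>E. tpow t e * \<psi> e s))"
    using gexp_normal_form[OF g(1)] by blast
  have "unif_littleo B (\<lambda>t s. w t s - (\<Sum>e\<in>E. tpow t e * \<psi> e s))"
    using unif_littleo_add[OF g(2) E(5)] by simp
  with E show ?thesis by blast
qed

end

section \<open>The ring of little-oh polynomials\<close>

lemma Ro_has_exp: 
  assumes "x \<in> Ro" shows "has_exp const_funs B (\<lambda>t s. x t)"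
proof -
  obtain r k \<alpha> a where x: "\<forall>i<k. 0 \<le> a i" "littleo (\<lambda>t. x t - (r + (\<Sum>i<(k::nat). \<alpha> i * tpow t (a i))))"
    using assms by (auto simp: Ro_def)
  have "has_exp const_funs B (\<lambda>t s. r + (\<Sum>i<k. \<alpha> i * tpow t (a i)))"
  proof (intro has_exp_add const_coeff.has_exp_sum)
    show "has_exp const_funs B (\<lambda>t s. r)" by (intro has_exp_coeff) auto
    fix i assume "i \<in> {..<k}"
    then have "(\<lambda>t s. tpow t (a i) * \<alpha> i) \<in> gexp (const_funs :: ('a \<Rightarrow> real) set)" using x by (intro gexp_monom) auto
    then show "has_exp const_funs B (\<lambda>t s. \<alpha> i * tpow t (a i))"
      unfolding has_exp_def by (rule bexI[rotated]) (simp add: mult.commute)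
  qed
  then show ?thesis using unif_littleo_const[OF x(2)] by (rule has_exp_perturb)
qed

lemma RoI_expansion:
  assumes E: "finite E" "E \<subseteq> {0..1}" and x: "littleo (\<lambda>t. x t - (\<Sum>e\<in>E. tpow t e * c e))"
  shows "x \<in> Ro"
proof -
  obtain h where h: "bij_betw h {0..<card E} E" using ex_bij_betw_nat_finite[OF E(1)] by blast
  have "(\<Sum>e\<in>E. tpow t e * c e) = (\<Sum>i<card E. c (h i) * tpow t (h i))" for t
    using sum.reindex_bij_betw[OF h, of "\<lambda>e. tpow t e * c e"] by (simp add: atLeast0LessThan mult.commute)
  then have "littleo (\<lambda>t. x t - (0 + (\<Sum>i<card E. c (h i) * tpow t (h i))))" using x by simp
  moreover have "\<forall>i<card E. 0 \<le> h i" using h E by (fastforce simp: bij_betw_def)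
  ultimately show ?thesis unfolding Ro_def by (intro CollectI exI conjI)
qed

lemma Ro_expansion:
  assumes "x \<in> Ro"
  shows "\<exists>E c. finite E \<and> E \<subseteq> {0..1} \<and> (\<forall>e. e \<notin> E \<longrightarrow> c e = 0) \<and> littleo (\<lambda>t. x t - (\<Sum>e\<in>E. tpow t e * c e))"
proof -
  obtain E \<psi> where E: "finite E" "E \<subseteq> {0..1}" "\<forall>e. e \<notin> E \<longrightarrow> \<psi> e = (\<lambda>_. 0)"
      "unif_littleo UNIV (\<lambda>t (s::unit). x t - (\<Sum>e\<in>E. tpow t e * \<psi> e s))"
    using const_coeff.has_exp_normal_form[OF Ro_has_exp[OF assms, of "UNIV :: unit set"]] by blast
  have "littleo (\<lambda>t. x t - (\<Sum>e\<in>E. tpow t e * \<psi> e ()))"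
    using unif_littleo_curve[OF E(4), of "\<lambda>_. ()"] by simp
  then show ?thesis using E by (intro exI[of _ E] exI[of _ "\<lambda>e. \<psi> e ()"]) auto
qed

text \<open>Transfers the closure rules of expansions to \<open>Ro\<close>; in particular the ring
  operations on \<open>Ro\<close> come for free.\<close>

lemma Ro_iff_has_exp: "x \<in> Ro \<longleftrightarrow> has_exp const_funs UNIV (\<lambda>t (s::unit). x t)"
proof
  assume x: "has_exp const_funs UNIV (\<lambda>t (s::unit). x t)"
  obtain E \<psi> where E: "finite E" "E \<subseteq> {0..1}" 
      "unif_littleo UNIV (\<lambda>t (s::unit). x t - (\<Sum>e\<in>E. tpow t e * \<psi> e s))"
    using const_coeff.has_exp_normal_form[OF x] by blast
  have "littleo (\<lambda>t. x t - (\<Sum>e\<in>E. tpow t e * \<psi> e ()))"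
    using unif_littleo_curve[OF E(3), of "\<lambda>_. ()"] by simp
  then show "x \<in> Ro" by (rule RoI_expansion[OF E(1,2)])
qed (rule Ro_has_exp)

lemma Ro_const [simp]: "(\<lambda>t. c) \<in> Ro"
  unfolding Ro_iff_has_exp by (intro has_exp_coeff) auto

lemma Ro_add: "x \<in> Ro \<Longrightarrow> y \<in> Ro \<Longrightarrow> (\<lambda>t. x t + y t) \<in> Ro"
  unfolding Ro_iff_has_exp by (rule has_exp_add)

lemma Ro_mult: "x \<in> Ro \<Longrightarrow> y \<in> Ro \<Longrightarrow> (\<lambda>t. x t * y t) \<in> Ro"
  unfolding Ro_iff_has_exp by (rule const_coeff.has_exp_mult)

lemma Ro_diff: "x \<in> Ro \<Longrightarrow> y \<in> Ro \<Longrightarrow> (\<lambda>t. x t - y t) \<in> Ro"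
  using Ro_add[OF _ Ro_mult[OF Ro_const[of "-1"]], of x y] by simp

lemma Ro_sum: "(\<And>i. i \<in> I \<Longrightarrow> x i \<in> Ro) \<Longrightarrow> (\<lambda>t. \<Sum>i\<in>I. x i t) \<in> Ro"
  by (induction I rule: infinite_finite_induct) (auto intro: Ro_add)

lemma Ro_power: "x \<in> Ro \<Longrightarrow> (\<lambda>t. x t ^ n) \<in> Ro"
  by (induction n) (auto intro: Ro_mult)

lemma Ro_tpow: "0 \<le> e \<Longrightarrow> (\<lambda>t. tpow t e) \<in> Ro"
  unfolding Ro_iff_has_exp has_exp_def
  by (rule bexI[OF _ gexp_monom[of e "\<lambda>_. 1"]]) auto

lemma Ro_perturb: "x \<in> Ro \<Longrightarrow> littleo (\<lambda>t. y t - x t) \<Longrightarrow> y \<in> Ro"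
  unfolding Ro_iff_has_exp littleo_unit by (rule has_exp_perturb)

lemma Ro_bounded: "x \<in> Ro \<Longrightarrow> unif_bounded B (\<lambda>t s. x t)"
  by (intro const_coeff.has_exp_bounded Ro_has_exp)

text \<open>A monomial with positive exponent is of this size, the \<open>o(t)\<close> remainder has
  exponent 1, and a sum takes the smaller exponent because \<open>t < 1\<close>. Both nilpotency and
  continuity at 0 follow from this bound.\<close>

lemma Ro_holder:
  assumes "x \<in> Ro"
  shows "\<exists>C \<eta>. 0 < \<eta> \<and> (\<forall>\<^sub>F t in near0. \<bar>x t - x 0\<bar> \<le> C * t powr \<eta>)"
proof -
  have add: "\<exists>C \<eta>. 0 < \<eta> \<and> (\<forall>\<^sub>F t in near0. \<bar>(v t + w t) - (v 0 + w 0)\<bar> \<le> C * t powr \<eta>)"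
    if v: "\<exists>C \<eta>. 0 < \<eta> \<and> (\<forall>\<^sub>F t in near0. \<bar>v t - v 0\<bar> \<le> C * t powr \<eta>)"
      and w: "\<exists>C \<eta>. 0 < \<eta> \<and> (\<forall>\<^sub>F t in near0. \<bar>w t - w 0\<bar> \<le> C * t powr \<eta>)" for v w :: "real \<Rightarrow> real"
  proof -
    obtain C \<eta> D \<theta> where 1: "0 < \<eta>" "\<forall>\<^sub>F t in near0. \<bar>v t - v 0\<bar> \<le> C * t powr \<eta>"
      and 2: "0 < \<theta>" "\<forall>\<^sub>F t in near0. \<bar>w t - w 0\<bar> \<le> D * t powr \<theta>"
      using v w by (elim exE conjE) (rule that)
    define \<mu> where "\<mu> = min \<eta> \<theta>"
    have "\<forall>\<^sub>F t in near0. \<bar>(v t + w t) - (v 0 + w 0)\<bar> \<le> (\<bar>C\<bar> + \<bar>D\<bar>) * t powr \<mu>"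
      using 1(2) 2(2) eventually_near0_nonneg eventually_near0_less[OF zero_less_one]
    proof eventually_elim
      case (elim t)
      have "t powr \<eta> \<le> t powr \<mu>" "t powr \<theta> \<le> t powr \<mu>"
        using elim by (cases "t = 0"; auto simp: \<mu>_def intro!: powr_mono')+
      then have "C * t powr \<eta> \<le> \<bar>C\<bar> * t powr \<mu>" "D * t powr \<theta> \<le> \<bar>D\<bar> * t powr \<mu>"
        by (intro mult_mono; simp)+
      then show ?case using elim by (simp add: distrib_right)
    qed
    then show ?thesis using 1 2 by (intro exI[of _ "\<bar>C\<bar> + \<bar>D\<bar>"] exI[of _ \<mu>]) (auto simp: \<mu>_def)
  qed
  obtain g where g: "g \<in> gexp const_funs" "unif_littleo UNIV (\<lambda>t (s::unit). x t - g t s)"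
    using assms unfolding Ro_iff_has_exp has_exp_def by blast
  have "\<exists>C \<eta>. 0 < \<eta> \<and> (\<forall>\<^sub>F t in near0. \<bar>g t () - g 0 ()\<bar> \<le> C * t powr \<eta>)"
    using g(1)
  proof (induction rule: gexp.induct)
    case (gexp_monom e \<phi>)
    show ?case
    proof (cases "e = 0")
      case True
      then show ?thesis by (intro exI[of _ 0] exI[of _ 1]) (simp add: tpow_def)
    next
      case False
      have "\<forall>\<^sub>F t in near0. \<bar>tpow t e * \<phi> () - tpow 0 e * \<phi> ()\<bar> \<le> \<bar>\<phi> ()\<bar> * t powr e"
        using False by (simp add: tpow_def abs_mult)
      then show ?thesis using False gexp_monom
        by (intro exI[of _ "\<bar>\<phi> ()\<bar>"] exI[of _ e]) simp
    qed
  qed (rule add)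
  moreover have "\<exists>C \<eta>. 0 < \<eta> \<and> (\<forall>\<^sub>F t in near0. \<bar>(x t - g t ()) - (x 0 - g 0 ())\<bar> \<le> C * t powr \<eta>)"
  proof -
    have o: "littleo (\<lambda>t. x t - g t ())"
      using unif_littleo_curve[OF g(2), of "\<lambda>_. ()"] by simp
    then have "\<forall>\<^sub>F t in near0. \<bar>x t - g t ()\<bar> \<le> 1 * t"
      unfolding littleo_iff by (meson zero_less_one)
    then have "\<forall>\<^sub>F t in near0. \<bar>(x t - g t ()) - (x 0 - g 0 ())\<bar> \<le> 1 * t powr 1"
      using eventually_near0_nonneg by eventually_elim (use littleo_at_0[OF o] in simp)
    then show ?thesis by (intro exI[of _ 1]) auto
  qed
  ultimately have "\<exists>C \<eta>. 0 < \<eta> \<and> (\<forall>\<^sub>F t in near0. \<bar>(g t () + (x t - g t ())) - (g 0 () + (x 0 - g 0 ()))\<bar> \<le> C * t powr \<eta>)"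
    by (rule add)
  then show ?thesis by simp
qed

text \<open>With \<open>n * \<eta> > 1\<close>, the n-th power of a quantity of size
  \<open>t powr \<eta>\<close> falls below \<open>t\<close>. All Taylor expansions in this
  development are cut at such an \<open>n\<close>.\<close>

lemma Ro_nilpotent:
  assumes "x \<in> Ro"
  shows "\<exists>n>0. littleo (\<lambda>t. (x t - x 0) ^ n)"
proof -
  obtain C \<eta> where \<eta>: "0 < \<eta>" "\<forall>\<^sub>F t in near0. \<bar>x t - x 0\<bar> \<le> C * t powr \<eta>"
    using Ro_holder[OF assms] by blast
  obtain n where n: "1 < real n * \<eta>" using \<eta>(1) reals_Archimedean3 by blast
  then have "n > 0" by (cases n) auto
  have "\<forall>\<^sub>F t in near0. \<bar>(x t - x 0) ^ n\<bar> \<le> C ^ n * \<bar>t powr (\<eta> * n)\<bar>"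
    using \<eta>(2) 
  proof eventually_elim
    case (elim t)
    have "\<bar>x t - x 0\<bar> ^ n \<le> (C * t powr \<eta>) ^ n" by (rule power_mono[OF elim]) simp
    also have "\<dots> = C ^ n * t powr (\<eta> * n)" using \<open>n > 0\<close> powr_power[of t \<eta> n] by (cases "t = 0") (auto simp: power_mult_distrib mult.commute)
    finally show ?case by (simp add: power_abs)
  qed
  then have "littleo (\<lambda>t. (x t - x 0) ^ n)"
    using n by (intro littleo_mono[OF littleo_powr]) (auto simp: mult.commute)
  then show ?thesis using \<open>n > 0\<close> by blast
qed

lemma Ro_eventually_in_open:
  assumes "x \<in> Ro" "open W" "x 0 \<in> W"
  shows "\<forall>\<^sub>F t in near0. x t \<in> W"
proof -
  obtain C \<eta> where \<eta>: "0 < \<eta>" "\<forall>\<^sub>F t in near0. \<bar>x t - x 0\<bar> \<le> C * t powr \<eta>"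
    using Ro_holder[OF assms(1)] by blast
  obtain r where r: "r > 0" "ball (x 0) r \<subseteq> W" using assms open_contains_ball by blast
  define d where "d = (r / (\<bar>C\<bar> + 1)) powr (1 / \<eta>)"
  have "d > 0" using r by (simp add: d_def)
  from eventually_near0_less[OF this] eventually_near0_nonneg \<eta>(2) show ?thesis
  proof eventually_elim
    case (elim t)
    have "t powr \<eta> < d powr \<eta>" using elim \<eta> by (intro powr_less_mono2) auto
    also have "\<dots> = r / (\<bar>C\<bar> + 1)" using r \<eta> by (simp add: d_def powr_powr)
    finally have *: "(\<bar>C\<bar> + 1) * t powr \<eta> < r" by (simp add: pos_less_divide_eq mult.commute)
    have "C * t powr \<eta> \<le> (\<bar>C\<bar> + 1) * t powr \<eta>" by (intro mult_right_mono) auto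
    then have "\<bar>x t - x 0\<bar> < r" using elim * by linarith
    then show ?case using r by (auto simp: dist_real_def abs_minus_commute)
  qed
qed

section \<open>Smooth functions of one variable\<close>

definition smooth1 :: "real set \<Rightarrow> (real \<Rightarrow> real) \<Rightarrow> bool" where
  "smooth1 W \<phi> \<longleftrightarrow> (\<forall>n. \<forall>s\<in>W. (deriv ^^ n) \<phi> differentiable (at s))"

lemma smooth1_DERIV:
  "smooth1 W \<phi> \<Longrightarrow> s \<in> W \<Longrightarrow> ((deriv ^^ n) \<phi> has_real_derivative (deriv ^^ Suc n) \<phi> s) (at s)"
  by (simp add: smooth1_def DERIV_deriv_iff_real_differentiable)

lemma smooth1_DERIV0:
  "smooth1 W \<phi> \<Longrightarrow> s \<in> W \<Longrightarrow> (\<phi> has_real_derivative deriv \<phi> s) (at s)"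
  using smooth1_DERIV[of W \<phi> s 0] by simp

lemma smooth1_deriv: "smooth1 W \<phi> \<Longrightarrow> smooth1 W (deriv \<phi>)"
  unfolding smooth1_def by (metis funpow_Suc_right comp_apply)

lemma smooth1_subset: "smooth1 W \<phi> \<Longrightarrow> W' \<subseteq> W \<Longrightarrow> smooth1 W' \<phi>"
  by (auto simp: smooth1_def)

text \<open>The sequence \<open>D\<close> is a certificate for all iterated derivatives at once.
  Openness of \<open>W\<close> matters because \<open>deriv\<close> looks at a whole neighbourhood,
  where \<open>\<phi>\<close> and \<open>D 0\<close> must agree.\<close>

lemma higher_deriv_eqI:
  assumes "open W" "\<And>n s. s \<in> W \<Longrightarrow> (D n has_real_derivative D (Suc n) s) (at s)"
    "\<And>s. s \<in> W \<Longrightarrow> \<phi> s = D 0 s"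
  shows "s \<in> W \<Longrightarrow> (deriv ^^ n) \<phi> s = D n s"
proof (induction n arbitrary: s)
  case (Suc n)
  have "((deriv ^^ n) \<phi> has_real_derivative D (Suc n) s) (at s)"
    using has_field_derivative_transform_within_open[OF assms(2)[OF Suc.prems] assms(1) Suc.prems, of n "(deriv ^^ n) \<phi>"] Suc.IH
    by simp
  then show ?case by (simp add: DERIV_imp_deriv)
qed (use assms in simp)

lemma smooth1I:
  assumes "open W" "\<And>n s. s \<in> W \<Longrightarrow> (D n has_real_derivative D (Suc n) s) (at s)"
    "\<And>s. s \<in> W \<Longrightarrow> \<phi> s = D 0 s"
  shows "smooth1 W \<phi>"
  unfolding smooth1_def
proof (intro allI ballI)
  fix n s assume s: "s \<in> W"
  have "((deriv ^^ n) \<phi> has_real_derivative D (Suc n) s) (at s)"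
    using has_field_derivative_transform_within_open[OF assms(2)[OF s] assms(1) s, of n "(deriv ^^ n) \<phi>"]
      higher_deriv_eqI[OF assms] by simp
  then show "(deriv ^^ n) \<phi> differentiable (at s)"
    by (auto simp: real_differentiable_def)
qed

lemma smooth1_cong:
  assumes "smooth1 W \<phi>" "open W" "\<And>s. s \<in> W \<Longrightarrow> \<psi> s = \<phi> s"
  shows "smooth1 W \<psi>"
  using assms by (intro smooth1I[where D = "\<lambda>n. (deriv ^^ n) \<phi>"]) (auto intro: smooth1_DERIV[simplified])

lemma smooth1_const: "open W \<Longrightarrow> smooth1 W (\<lambda>s. c)"
  by (rule smooth1I[where D = "\<lambda>n s. if n = 0 then c else 0"]) auto

lemma smooth1_add: "open W \<Longrightarrow> smooth1 W \<phi> \<Longrightarrow> smooth1 W \<psi> \<Longrightarrow> smooth1 W (\<lambda>s. \<phi> s + \<psi> s)"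
  by (rule smooth1I[where D = "\<lambda>n s. (deriv ^^ n) \<phi> s + (deriv ^^ n) \<psi> s"])
     (auto intro!: DERIV_add smooth1_DERIV[simplified])

lemma smooth1_scale: "open W \<Longrightarrow> smooth1 W \<phi> \<Longrightarrow> smooth1 W (\<lambda>s. \<phi> s * c)"
  by (rule smooth1I[where D = "\<lambda>n s. (deriv ^^ n) \<phi> s * c"])
     (auto intro!: DERIV_cmult_right smooth1_DERIV[simplified])

lemma smooth1_diff: "open W \<Longrightarrow> smooth1 W \<phi> \<Longrightarrow> smooth1 W \<psi> \<Longrightarrow> smooth1 W (\<lambda>s. \<phi> s - \<psi> s)"
  using smooth1_add[OF _ _ smooth1_scale[of W \<psi> "-1"]] by simp

lemma smooth1_antiderivative:
  assumes "open W" "smooth1 W \<phi>" "\<And>s. s \<in> W \<Longrightarrow> (\<Phi> has_real_derivative \<phi> s) (at s)"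
  shows "smooth1 W \<Phi>"
  by (rule smooth1I[where D = "\<lambda>n. case n of 0 \<Rightarrow> \<Phi> | Suc m \<Rightarrow> (deriv ^^ m) \<phi>"])
     (use assms in \<open>auto split: nat.split intro: smooth1_DERIV[simplified]\<close>)

lemma smooth1_isCont: "smooth1 W \<phi> \<Longrightarrow> s \<in> W \<Longrightarrow> isCont ((deriv ^^ n) \<phi>) s"
  using DERIV_isCont smooth1_DERIV by blast

lemma smooth1_bounded:
  assumes "smooth1 W \<phi>" "compact K" "K \<subseteq> W"
  shows "\<exists>M. \<forall>s\<in>K. \<bar>(deriv ^^ n) \<phi> s\<bar> \<le> M"
proof -
  have "continuous_on K ((deriv ^^ n) \<phi>)"
    using assms smooth1_isCont by (intro continuous_at_imp_continuous_on) blast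
  then have "bounded ((deriv ^^ n) \<phi> ` K)"
    using assms by (intro compact_imp_bounded compact_continuous_image)
  then show ?thesis unfolding bounded_iff by auto
qed

lemma coeff_space_smooth1:
  assumes "open W" "compact K" "K \<subseteq> W" "B \<subseteq> K"
  shows "coeff_space {\<phi>. smooth1 W \<phi>} B"
proof
  fix \<phi> assume "\<phi> \<in> {\<phi>. smooth1 W \<phi>}"
  then show "\<exists>M. \<forall>s\<in>B. \<bar>\<phi> s\<bar> \<le> M"
    using smooth1_bounded[of W \<phi> K 0] assms by auto
qed (auto intro: smooth1_const smooth1_add smooth1_scale assms)

section \<open>Taylor expansion along curves of little-oh polynomials\<close>

text \<open>Lagrange's form of the remainder with the factorial estimated away. It is stated for a
  sequence \<open>D\<close>, not for iterated \<open>deriv\<close>, so that it also applies to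
  repeated partial derivatives in one parameter. The case \<open>x = c\<close> is separate because
  Lagrange's form presupposes distinct points.\<close>

lemma taylor_remainder:
  fixes D :: "nat \<Rightarrow> real \<Rightarrow> real"
  assumes "0 < n" and D: "\<And>m \<sigma>. m < n \<Longrightarrow> \<sigma> \<in> {min c x..max c x} \<Longrightarrow> (D m has_real_derivative D (Suc m) \<sigma>) (at \<sigma>)"
    and M: "\<And>\<sigma>. \<sigma> \<in> {min c x..max c x} \<Longrightarrow> \<bar>D n \<sigma>\<bar> \<le> M"
  shows "\<bar>D 0 x - (\<Sum>m<n. D m c / fact m * (x - c) ^ m)\<bar> \<le> M * \<bar>x - c\<bar> ^ n"
proof (cases "x = c")
  case True
  have "(\<Sum>m<n. D m c / fact m * (x - c) ^ m) = (\<Sum>m\<in>{0}. D m c / fact m * (x - c) ^ m)"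
    using True \<open>0 < n\<close> by (intro sum.mono_neutral_right) auto
  then show ?thesis using True \<open>0 < n\<close> by (simp add: zero_power)
next
  case False
  obtain \<sigma> where \<sigma>: "if x < c then x < \<sigma> \<and> \<sigma> < c else c < \<sigma> \<and> \<sigma> < x"
    "D 0 x = (\<Sum>m<n. (D m c / fact m) * (x - c) ^ m) + (D n \<sigma> / fact n) * (x - c) ^ n"
    using Taylor[OF \<open>0 < n\<close> refl, of "min c x" "max c x" D c x] D False by auto
  then have "\<sigma> \<in> {min c x..max c x}" by (auto split: if_splits)
  then have "\<bar>D n \<sigma>\<bar> \<le> M" by (rule M)
  moreover have "\<bar>D n \<sigma>\<bar> / fact n \<le> \<bar>D n \<sigma>\<bar> / 1" by (intro divide_left_mono) (auto simp: fact_ge_1)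
  ultimately have "\<bar>D n \<sigma>\<bar> / fact n * \<bar>x - c\<bar> ^ n \<le> M * \<bar>x - c\<bar> ^ n"
    by (intro mult_right_mono) auto
  then show ?thesis using \<sigma>(2) by (simp add: abs_mult power_abs)
qed

text \<open>Nilpotency of \<open>y t - y 0\<close> turns the remainder into \<open>o(t)\<close>:
  modulo \<open>o(t)\<close> a smooth function along a curve is a polynomial in that increment,
  determined by finitely many derivatives at the standard part.\<close>

lemma smooth1_curve_taylor:
  assumes W: "open W" "smooth1 W \<phi>" and y: "y \<in> Ro" "y 0 \<in> W"
  shows "\<exists>n. littleo (\<lambda>t. \<phi> (y t) - (\<Sum>m<n. (deriv ^^ m) \<phi> (y 0) / fact m * (y t - y 0) ^ m))"
proof -
  obtain n where n: "0 < n" "littleo (\<lambda>t. (y t - y 0) ^ n)"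
    using Ro_nilpotent[OF y(1)] by blast
  obtain r where r: "r > 0" "cball (y 0) r \<subseteq> W" using W y open_contains_cball by blast
  obtain M where M: "\<forall>s\<in>cball (y 0) r. \<bar>(deriv ^^ n) \<phi> s\<bar> \<le> M"
    using smooth1_bounded[OF W(2) compact_cball r(2)] by blast
  have "\<forall>\<^sub>F t in near0. y t \<in> ball (y 0) r"
    using r by (intro Ro_eventually_in_open[OF y(1)]) auto
  then have "\<forall>\<^sub>F t in near0. \<bar>\<phi> (y t) - (\<Sum>m<n. (deriv ^^ m) \<phi> (y 0) / fact m * (y t - y 0) ^ m)\<bar> \<le> M * \<bar>(y t - y 0) ^ n\<bar>"
  proof eventually_elim
    case (elim t)
    then have *: "\<sigma> \<in> cball (y 0) r" if "\<sigma> \<in> {min (y 0) (y t)..max (y 0) (y t)}" for \<sigma>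
      using that by (auto simp: dist_real_def)
    have "\<bar>(deriv ^^ 0) \<phi> (y t) - (\<Sum>m<n. (deriv ^^ m) \<phi> (y 0) / fact m * (y t - y 0) ^ m)\<bar> \<le> M * \<bar>y t - y 0\<bar> ^ n"
      using M * r by (intro taylor_remainder n(1) smooth1_DERIV[OF W(2)]) blast+
    then show ?case by (simp add: power_abs)
  qed
  with n(2) have "littleo (\<lambda>t. \<phi> (y t) - (\<Sum>m<n. (deriv ^^ m) \<phi> (y 0) / fact m * (y t - y 0) ^ m))"
    by (rule littleo_mono)
  then show ?thesis by blast
qed

lemma smooth1_Ro:
  assumes "open W" "smooth1 W \<phi>" "y \<in> Ro" "y 0 \<in> W"
  shows "(\<lambda>t. \<phi> (y t)) \<in> Ro"
proof -
  obtain n where "littleo (\<lambda>t. \<phi> (y t) - (\<Sum>m<n. (deriv ^^ m) \<phi> (y 0) / fact m * (y t - y 0) ^ m))"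
    using smooth1_curve_taylor[OF assms] by blast
  moreover have "(\<lambda>t. \<Sum>m<n. (deriv ^^ m) \<phi> (y 0) / fact m * (y t - y 0) ^ m) \<in> Ro"
    by (intro Ro_sum Ro_mult Ro_power Ro_diff Ro_const assms)
  ultimately show ?thesis by (rule Ro_perturb[rotated])
qed

text \<open>At a boundary point of \<open>T\<close> all derivatives vanish, so Taylor's formula leaves only a remainder
of arbitrarily high order along a curve that may leave \<open>T\<close> immediately.\<close>
lemma flat_littleo:
  assumes W: "open W" "smooth1 W \<phi>" and T: "open T" "T \<subseteq> W" "\<And>s. s \<in> T \<Longrightarrow> \<phi> s = 0"
    and y: "y \<in> Ro" "y 0 \<in> W" "y 0 \<in> closure T"
  shows "littleo (\<lambda>t. \<phi> (y t))"
proof -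
  have "(deriv ^^ m) \<phi> (y 0) = 0" for m
  proof -
    have "(deriv ^^ m) \<phi> s = 0" if "s \<in> T" for s
      using higher_deriv_eqI[OF T(1), of "\<lambda>_ _. 0" \<phi> s m] T that by simp
    moreover obtain X where X: "\<forall>k. X k \<in> T" "X \<longlonglongrightarrow> y 0"
      using y(3) closure_sequential by blast
    ultimately have "(\<lambda>k. (deriv ^^ m) \<phi> (X k)) \<longlonglongrightarrow> 0" by simp
    moreover have "(\<lambda>k. (deriv ^^ m) \<phi> (X k)) \<longlonglongrightarrow> (deriv ^^ m) \<phi> (y 0)"
      using smooth1_isCont[OF W(2) y(2)] X(2) by (rule isCont_tendsto_compose)
    ultimately show ?thesis using LIMSEQ_unique by blast
  qed
  then show ?thesis using smooth1_curve_taylor[OF W y(1,2)] by simp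
qed

text \<open>A local Lipschitz bound, obtained from Taylor's formula of order 1 on a compact ball. It
  makes the extension of \<open>\<phi>\<close> to Fermat reals independent of the
  representative.\<close>

lemma smooth1_curve_cong:
  assumes W: "open W" "smooth1 W \<phi>" and y: "y \<in> Ro" "z \<in> Ro" "littleo (\<lambda>t. y t - z t)" "y 0 \<in> W"
  shows "littleo (\<lambda>t. \<phi> (y t) - \<phi> (z t))"
proof -
  have z0: "z 0 = y 0" using littleo_at_0[OF y(3)] by simp
  obtain r where r: "r > 0" "cball (y 0) r \<subseteq> W" using W y open_contains_cball by blast
  obtain M where M: "\<forall>s\<in>cball (y 0) r. \<bar>(deriv ^^ 1) \<phi> s\<bar> \<le> M"
    using smooth1_bounded[OF W(2) compact_cball r(2)] by blast
  have "\<forall>\<^sub>F t in near0. y t \<in> ball (y 0) r" "\<forall>\<^sub>F t in near0. z t \<in> ball (y 0) r"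
    using r z0 by (intro Ro_eventually_in_open y; simp)+
  then have "\<forall>\<^sub>F t in near0. \<bar>\<phi> (y t) - \<phi> (z t)\<bar> \<le> M * \<bar>y t - z t\<bar>"
  proof eventually_elim
    case (elim t)
    then have *: "\<sigma> \<in> cball (y 0) r" if "\<sigma> \<in> {min (z t) (y t)..max (z t) (y t)}" for \<sigma>
      using that by (auto simp: dist_real_def)
    have "\<bar>(deriv ^^ 0) \<phi> (y t) - (\<Sum>m<1. (deriv ^^ m) \<phi> (z t) / fact m * (y t - z t) ^ m)\<bar> \<le> M * \<bar>y t - z t\<bar> ^ 1"
      using M * r by (intro taylor_remainder zero_less_one smooth1_DERIV[OF W(2)]) blast+
    then show ?case by simp
  qed
  with y(3) show ?thesis by (rule littleo_mono)
qed

section \<open>Fermat reals and their representatives\<close>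

lemma rep_fermat_Ro [simp]: "rep_fermat x \<in> Ro"
  using Quotient3_rep_reflp[OF Quotient3_fermat, of x] by (simp add: ferm_rel_def)

lemma abs_rep_fermat: "abs_fermat (rep_fermat x) = x"
  by (rule Quotient3_abs_rep[OF Quotient3_fermat])

lemma abs_fermat_eq_iff:
  assumes "x \<in> Ro" "y \<in> Ro"
  shows "abs_fermat x = abs_fermat y \<longleftrightarrow> littleo (\<lambda>t. x t - y t)"
  using Quotient3_rel[OF Quotient3_fermat, of x y] assms by (auto simp: ferm_rel_def littleo_zero)

lemma rep_abs_fermat: "x \<in> Ro \<Longrightarrow> littleo (\<lambda>t. rep_fermat (abs_fermat x) t - x t)"
  using abs_fermat_eq_iff[of "rep_fermat (abs_fermat x)" x] by (simp add: abs_rep_fermat)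

lemma rep_fermat_0: "rep_fermat x 0 = st x"
  by (simp add: st_def)

lemma st_abs_fermat: "x \<in> Ro \<Longrightarrow> st (abs_fermat x) = x 0"
  using littleo_at_0[OF rep_abs_fermat] by (simp add: st_def)

lemma st_fconst [simp]: "st (fconst r) = r"
  by (simp add: fconst_def st_abs_fermat)

lemma fle_st: "fle x y \<Longrightarrow> st x \<le> st y"
  unfolding fle_def st_def by (metis add.right_neutral littleo_at_0 order_refl)

lemma st_less_imp_fle:
  assumes "st x < st y" shows "fle x y"
proof -
  have "\<forall>\<^sub>F t in near0. rep_fermat y t - rep_fermat x t \<in> {0<..}"
    using assms by (intro Ro_eventually_in_open Ro_diff) (auto simp: rep_fermat_0)
  then show ?thesis unfolding fle_def eventually_near0
    by (intro exI[of _ "\<lambda>_. 0"] conjI) (auto simp: littleo_zero intro: less_imp_le)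
qed

lemma fle_refl: "fle x x"
  unfolding fle_def by (intro exI[of _ "\<lambda>_. 0"]) (auto simp: littleo_zero intro: exI[of _ 1])

lemma st_fint: "x \<in> fint a b \<Longrightarrow> st x \<in> {st a..st b}"
  by (auto simp: fint_def fle_st)

text \<open>The endpoints are excluded because \<open>fconst (st a)\<close> may lie infinitesimally
  below \<open>a\<close>, and \<open>fconst (st b)\<close> above \<open>b\<close>. For this reason
  coefficients are compared only at interior standard points.\<close>

lemma fconst_fint: "s \<in> {st a<..<st b} \<Longrightarrow> fconst s \<in> fint a b"
  by (auto simp: fint_def intro: st_less_imp_fle)

lemma fint_st_surj:
  assumes "st a < st b" "s \<in> {st a..st b}"
  shows "\<exists>x\<in>fint a b. st x = s"
proof -
  consider "s = st a" | "s = st b" | "s \<in> {st a<..<st b}" using assms by force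
  then show ?thesis
  proof cases
    case 3
    then show ?thesis using fconst_fint by (intro bexI[of _ "fconst s"]) auto
  qed (use assms in \<open>auto simp: fint_def intro: fle_refl st_less_imp_fle\<close>)
qed

section \<open>Functions given by expansions with smooth coefficients\<close>

definition fex :: "real set \<Rightarrow> (real \<Rightarrow> real \<Rightarrow> real) \<Rightarrow> fermat \<Rightarrow> fermat" where
  "fex E \<psi> x = abs_fermat (\<lambda>t. \<Sum>e\<in>E. tpow t e * \<psi> e (rep_fermat x t))"

definition coeffs :: "real set \<Rightarrow> real set \<Rightarrow> (real \<Rightarrow> real \<Rightarrow> real) \<Rightarrow> bool" where
  "coeffs W E \<psi> \<longleftrightarrow> finite E \<and> E \<subseteq> {0..1} \<and> (\<forall>e. smooth1 W (\<psi> e)) \<and> (\<forall>e. e \<notin> E \<longrightarrow> \<psi> e = (\<lambda>_. 0))"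

lemma expansion_Ro:
  assumes "open W" "coeffs W E \<psi>" "y \<in> Ro" "y 0 \<in> W"
  shows "(\<lambda>t. \<Sum>e\<in>E. tpow t e * \<psi> e (y t)) \<in> Ro"
proof (intro Ro_sum Ro_mult)
  fix e assume "e \<in> E"
  then show "(\<lambda>t. tpow t e) \<in> Ro" using assms(2) by (intro Ro_tpow) (auto simp: coeffs_def)
  show "(\<lambda>t. \<psi> e (y t)) \<in> Ro" using assms by (intro smooth1_Ro[OF assms(1) _ assms(3,4)]) (simp add: coeffs_def)
qed

lemma littleo_tpow_sum:
  assumes "E \<subseteq> {0..1}" "\<And>e. e \<in> E \<Longrightarrow> littleo (w e)"
  shows "littleo (\<lambda>t. \<Sum>e\<in>E. tpow t e * w e t)"
proof (rule littleo_sum)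
  fix e assume "e \<in> E"
  then show "littleo (\<lambda>t. tpow t e * w e t)"
    using littleo_mult[OF assms(2) unif_bounded_tpow[of e]] assms(1) by (auto simp: mult.commute)
qed

text \<open>\<open>fex\<close> reads the representative picked by \<open>rep_fermat\<close>; any
  other curve for the same point may be used instead, notably the constant one at a standard
  point.\<close>

lemma fex_abs_fermat:
  assumes W: "open W" "coeffs W E \<psi>" and y: "y \<in> Ro" "y 0 \<in> W"
  shows "fex E \<psi> (abs_fermat y) = abs_fermat (\<lambda>t. \<Sum>e\<in>E. tpow t e * \<psi> e (y t))"
proof -
  let ?z = "rep_fermat (abs_fermat y)"
  have z0: "?z 0 \<in> W" using y by (simp add: rep_fermat_0 st_abs_fermat)
  have "littleo (\<lambda>t. \<Sum>e\<in>E. tpow t e * (\<psi> e (?z t) - \<psi> e (y t)))"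
  proof (rule littleo_tpow_sum)
    fix e
    show "littleo (\<lambda>t. \<psi> e (?z t) - \<psi> e (y t))"
      using W by (intro smooth1_curve_cong[OF W(1) _ rep_fermat_Ro y(1) rep_abs_fermat[OF y(1)] z0])
        (simp add: coeffs_def)
  qed (use W in \<open>simp add: coeffs_def\<close>)
  then show ?thesis
    unfolding fex_def using expansion_Ro[OF W y] expansion_Ro[OF W rep_fermat_Ro z0]
    by (simp add: abs_fermat_eq_iff sum_subtractf right_diff_distrib)
qed

lemma coeffs_subset: "coeffs W E \<psi> \<Longrightarrow> W' \<subseteq> W \<Longrightarrow> coeffs W' E \<psi>"
  unfolding coeffs_def using smooth1_subset by blast

lemma coeffs_enlarge:
  assumes "coeffs W E \<psi>" "E \<subseteq> F" "finite F" "F \<subseteq> {0..1}"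
  shows "coeffs W F \<psi>" "(\<Sum>e\<in>F. tpow t e * \<psi> e s) = (\<Sum>e\<in>E. tpow t e * \<psi> e s)" "fex F \<psi> = fex E \<psi>"
proof -
  show "coeffs W F \<psi>" using assms by (auto simp: coeffs_def)
  show sum: "(\<Sum>e\<in>F. tpow t e * \<psi> e s) = (\<Sum>e\<in>E. tpow t e * \<psi> e s)" for t s
    using assms by (intro sum.mono_neutral_right) (auto simp: coeffs_def)
  show "fex F \<psi> = fex E \<psi>" by (simp add: fex_def fun_eq_iff sum)
qed

lemma coeffs_deriv: "coeffs W E \<psi> \<Longrightarrow> coeffs W E (\<lambda>e. deriv (\<psi> e))"
  by (simp add: coeffs_def smooth1_deriv)

section \<open>Rigidity of expansions\<close>

text \<open>At a standard point the coefficients are plain numbers, and a combination of distinct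
  powers with exponents in [0, 1] is \<open>o(t)\<close> only if it is trivial.\<close>

lemma fex_unique:
  assumes W: "open W" "coeffs W E \<psi>" "s \<in> W" and W': "open W'" "coeffs W' E \<theta>" "s \<in> W'"
    and eq: "fex E \<psi> (fconst s) = fex E \<theta> (fconst s)"
  shows "\<psi> e s = \<theta> e s"
proof -
  have "littleo (\<lambda>t. (\<Sum>e\<in>E. tpow t e * \<psi> e s) - (\<Sum>e\<in>E. tpow t e * \<theta> e s))"
    using eq abs_fermat_eq_iff[OF expansion_Ro[OF W(1,2) Ro_const W(3)] expansion_Ro[OF W'(1,2) Ro_const W'(3)]]
    unfolding fconst_def fex_abs_fermat[OF W(1,2) Ro_const W(3)] fex_abs_fermat[OF W'(1,2) Ro_const W'(3)]
    by blast
  then have "littleo (\<lambda>t. \<Sum>e\<in>E. tpow t e * (\<psi> e s - \<theta> e s))"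
    by (simp add: sum_subtractf right_diff_distrib)
  then have "\<forall>e\<in>E. \<psi> e s - \<theta> e s = 0"
    using W(2) by (intro tpow_sum_littleoD) (auto simp: coeffs_def)
  then show ?thesis using W(2) W'(2) by (cases "e \<in> E") (auto simp: coeffs_def)
qed

text \<open>Flatness of each coefficient difference carries equality from the interior to points
  whose standard part is an endpoint.\<close>

lemma fex_eq_on_closure:
  assumes W: "open W" "coeffs W E \<psi>" "coeffs W E \<theta>"
    and T: "open T" "T \<subseteq> W" "\<And>e s. s \<in> T \<Longrightarrow> \<psi> e s = \<theta> e s" and x: "st x \<in> W" "st x \<in> closure T"
  shows "fex E \<psi> x = fex E \<theta> x"
proof -
  have x0: "rep_fermat x 0 \<in> W" "rep_fermat x 0 \<in> closure T" using x by (simp_all add: rep_fermat_0)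
  have "littleo (\<lambda>t. \<Sum>e\<in>E. tpow t e * (\<psi> e (rep_fermat x t) - \<theta> e (rep_fermat x t)))"
  proof (rule littleo_tpow_sum)
    fix e
    have "smooth1 W (\<lambda>s. \<psi> e s - \<theta> e s)" using W by (intro smooth1_diff) (simp_all add: coeffs_def)
    from flat_littleo[OF W(1) this T(1,2) _ rep_fermat_Ro x0] T(3)
    show "littleo (\<lambda>t. \<psi> e (rep_fermat x t) - \<theta> e (rep_fermat x t))" by simp
  qed (use W in \<open>simp add: coeffs_def\<close>)
  then show ?thesis
    unfolding fex_def using expansion_Ro[OF W(1,2) rep_fermat_Ro x0(1)] expansion_Ro[OF W(1,3) rep_fermat_Ro x0(1)]
    by (simp add: abs_fermat_eq_iff sum_subtractf right_diff_distrib)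
qed

lemma fex_deriv_eq_on_closure:
  assumes W: "open W" "coeffs W E \<psi>" "coeffs W E \<theta>"
    and T: "open T" "T \<subseteq> W" "\<And>e s. s \<in> T \<Longrightarrow> \<psi> e s = \<theta> e s" and x: "st x \<in> W" "st x \<in> closure T"
  shows "fex E (\<lambda>e. deriv (\<psi> e)) x = fex E (\<lambda>e. deriv (\<theta> e)) x"
proof (rule fex_eq_on_closure[OF W(1) coeffs_deriv[OF W(2)] coeffs_deriv[OF W(3)] T(1,2) _ x])
  fix e s assume s: "s \<in> T"
  have "\<forall>\<^sub>F r in nhds s. \<psi> e r = \<theta> e r"
    using eventually_nhds_in_open[OF T(1) s] by (rule eventually_mono) (simp add: T(3))
  then show "deriv (\<psi> e) s = deriv (\<theta> e) s" by (rule deriv_cong_ev) simp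
qed

section \<open>Expansion of smooth functions of several variables\<close>

lemma iter_pd_DERIV:
  assumes "smooth_k k U g" "set js \<subseteq> {..<k}" "j < k" "w(j := \<sigma>) \<in> U"
  shows "((\<lambda>s. iter_pd js g (w(j := s))) has_real_derivative iter_pd (j # js) g (w(j := \<sigma>))) (at \<sigma>)"
proof -
  have "(\<lambda>s. iter_pd js g ((w(j := \<sigma>))(j := s))) differentiable (at ((w(j := \<sigma>)) j))"
    using assms unfolding smooth_k_def by blast
  then show ?thesis
    by (simp add: pd_def DERIV_deriv_iff_real_differentiable)
qed

text \<open>Tychonoff's theorem for the product topology on sequences. Vectors of
  \<open>rk k\<close> are sequences, so the box used later has degenerate sides from index
  \<open>k\<close> on.\<close>

lemma compact_box: "compact {u :: nat \<Rightarrow> real. \<forall>i. l i \<le> u i \<and> u i \<le> h i}"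
proof -
  have "{u :: nat \<Rightarrow> real. \<forall>i. l i \<le> u i \<and> u i \<le> h i} = PiE UNIV (\<lambda>i. {l i..h i})"
    by (auto simp: PiE_def)
  moreover have "compactin (product_topology (\<lambda>i::nat. euclideanreal) UNIV) (PiE UNIV (\<lambda>i. {l i..h i}))"
    by (subst compactin_PiE) (auto simp: compactin_euclidean_iff)
  ultimately show ?thesis
    by (simp add: euclidean_product_topology compactin_euclidean_iff)
qed

text \<open>\<open>cont_k\<close> constrains only finitely many coordinates, and each projection is
  continuous in the product topology.\<close>

lemma cont_k_continuous_on:
  assumes "cont_k k U g" "K \<subseteq> U"
  shows "continuous_on K g"
  unfolding continuous_on_def
proof
  fix u assume u: "u \<in> K"
  show "(g \<longlongrightarrow> g u) (at u within K)"
  proof (rule tendstoI)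
    fix e :: real assume "e > 0"
    then obtain d where d: "d > 0" "\<And>v. v \<in> U \<Longrightarrow> (\<forall>i<k. \<bar>v i - u i\<bar> < d) \<Longrightarrow> \<bar>g v - g u\<bar> < e"
      using assms u unfolding cont_k_def by (metis subsetD)
    have "\<forall>\<^sub>F v in at u within K. dist (v i) (u i) < d" for i
    proof -
      have "continuous_on K (\<lambda>v. v i)"
        by (rule continuous_on_subset[OF continuous_on_product_coordinates subset_UNIV])
      then have "((\<lambda>v. v i) \<longlongrightarrow> u i) (at u within K)"
        using u by (simp add: continuous_on_def)
      then show ?thesis using d(1) by (rule tendstoD)
    qed
    then have "\<forall>\<^sub>F v in at u within K. \<forall>i\<in>{..<k}. dist (v i) (u i) < d"
      by (intro eventually_ball_finite) auto
    moreover have "\<forall>\<^sub>F v in at u within K. v \<in> K"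
      by (simp add: eventually_at_filter)
    ultimately show "\<forall>\<^sub>F v in at u within K. dist (g v) (g u) < e"
    proof eventually_elim
      case (elim v)
      then have "v \<in> U" "\<forall>i<k. \<bar>v i - u i\<bar> < d"
        using assms(2) by (auto simp: dist_real_def)
      then show ?case using d(2) by (simp add: dist_real_def)
    qed
  qed
qed

text \<open>The first \<open>k\<close> parameters follow their curves, the remaining ones are frozen at their standard parts.\<close>
definition partial_args :: "(nat \<Rightarrow> real \<Rightarrow> real) \<Rightarrow> nat \<Rightarrow> nat \<Rightarrow> real \<Rightarrow> real \<Rightarrow> nat \<Rightarrow> real" where
  "partial_args q p k t s = (\<lambda>i. if i < k then q i t else if i < p then q i 0 else if i = p then s else 0)"

text \<open>The closed box around the standard values is compact, so every iterated partial
  derivative is bounded on it. These bounds are the remainder constants, and they do not depend on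
  \<open>s\<close>.\<close>

locale parametrized_smooth =
  fixes p :: nat and P :: "(nat \<Rightarrow> real) set" and V :: "real set" and \<alpha> :: "(nat \<Rightarrow> real) \<Rightarrow> real"
    and q :: "nat \<Rightarrow> real \<Rightarrow> real" and s0 \<rho> :: real
  assumes V: "open V"
    and smooth: "smooth_k (Suc p) (prodset p P V) \<alpha>"
    and q: "\<And>i. i < p \<Longrightarrow> q i \<in> Ro"
    and rho: "\<rho> > 0"
    and box: "\<And>u. u \<in> rk (Suc p) \<Longrightarrow> (\<And>i. i < p \<Longrightarrow> \<bar>u i - q i 0\<bar> \<le> \<rho>) \<Longrightarrow> \<bar>u p - s0\<bar> \<le> \<rho> \<Longrightarrow> u \<in> prodset p P V"
begin

abbreviation "U \<equiv> prodset p P V"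
abbreviation "B \<equiv> ball s0 \<rho>"

definition "K = {u. \<forall>i. (if i < p then q i 0 - \<rho> else if i = p then s0 - \<rho> else 0) \<le> u i \<and>
  u i \<le> (if i < p then q i 0 + \<rho> else if i = p then s0 + \<rho> else 0)}"

lemma K_iff: "u \<in> K \<longleftrightarrow> u \<in> rk (Suc p) \<and> (\<forall>i<p. \<bar>u i - q i 0\<bar> \<le> \<rho>) \<and> \<bar>u p - s0\<bar> \<le> \<rho>"
  (is "?l \<longleftrightarrow> ?r")
proof
  assume u: ?l
  have "u i = 0" if "i \<ge> Suc p" for i
    using u that unfolding K_def by (auto dest!: spec[of _ i])
  moreover have "\<bar>u i - q i 0\<bar> \<le> \<rho>" if "i < p" for i
    using u that unfolding K_def by (auto dest!: spec[of _ i] simp: abs_le_iff)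
  moreover have "\<bar>u p - s0\<bar> \<le> \<rho>"
    using u unfolding K_def by (auto dest!: spec[of _ p] simp: abs_le_iff)
  ultimately show ?r by (auto simp: rk_def)
next
  assume ?r
  then show ?l unfolding K_def rk_def by (auto simp: abs_le_iff algebra_simps)
qed

lemma K_subset: "K \<subseteq> U"
  using box by (auto simp: K_iff)

lemma iter_pd_bounded_on_K:
  assumes "set js \<subseteq> {..<Suc p}"
  shows "\<exists>M. \<forall>u\<in>K. \<bar>iter_pd js \<alpha> u\<bar> \<le> M"
proof -
  have "compact K" unfolding K_def by (rule compact_box)
  moreover have "continuous_on K (iter_pd js \<alpha>)"
    using smooth assms K_subset by (intro cont_k_continuous_on[of "Suc p" U]) (auto simp: smooth_k_def)
  ultimately have "bounded (iter_pd js \<alpha> ` K)"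
    by (intro compact_imp_bounded compact_continuous_image)
  then show ?thesis unfolding bounded_iff by auto
qed

lemma partial_args_K:
  assumes "s \<in> B" "\<And>i. i < p \<Longrightarrow> \<bar>q i t - q i 0\<bar> \<le> \<rho>" "k \<le> p"
  shows "partial_args q p k t s \<in> K"
  using assms rho by (auto simp: K_iff partial_args_def rk_def dist_real_def abs_minus_commute)

lemma eventually_close: "\<forall>\<^sub>F t in near0. \<forall>i<p. \<bar>q i t - q i 0\<bar> \<le> \<rho>"
proof -
  have "\<forall>\<^sub>F t in near0. q i t \<in> ball (q i 0) \<rho>" if "i < p" for i
    using that rho by (intro Ro_eventually_in_open q) auto
  then have "\<forall>\<^sub>F t in near0. \<forall>i\<in>{..<p}. q i t \<in> ball (q i 0) \<rho>"
    by (intro eventually_ball_finite) auto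
  then show ?thesis by (rule eventually_mono) (auto simp: dist_real_def abs_minus_commute less_imp_le)
qed

lemma cball_subset: "cball s0 \<rho> \<subseteq> V"
proof
  fix s assume "s \<in> cball s0 \<rho>"
  then have "partial_args q p 0 0 s \<in> K"
    using rho by (auto simp: K_iff partial_args_def rk_def dist_real_def abs_minus_commute)
  then have "partial_args q p 0 0 s \<in> U" using K_subset by blast
  then show "s \<in> V" by (simp add: prodset_def partial_args_def)
qed

text \<open>With all parameters frozen, \<open>s\<close> may range over all of \<open>V\<close>,
  because the domain is a product. The coefficients are therefore smooth on an open neighbourhood of
  the closed ball, hence bounded on \<open>B\<close>.\<close>

lemma standard_args_U:
  assumes "s \<in> V" shows "partial_args q p 0 0 s \<in> U"
proof -
  have "partial_args q p 0 0 s0 \<in> K"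
    using rho by (auto simp: K_iff partial_args_def rk_def)
  then have "partial_args q p 0 0 s0 \<in> U" using K_subset by blast
  moreover have "(\<lambda>i. if i < p then partial_args q p 0 0 s i else 0) = (\<lambda>i. if i < p then partial_args q p 0 0 s0 i else 0)"
    by (simp add: partial_args_def fun_eq_iff)
  moreover have "partial_args q p 0 0 s \<in> rk (Suc p)" "partial_args q p 0 0 s p = s"
    by (simp_all add: partial_args_def rk_def)
  ultimately show ?thesis using assms unfolding prodset_def by simp
qed

sublocale coeff_space "{\<phi>. smooth1 V \<phi>}" B
  by (rule coeff_space_smooth1[OF V compact_cball cball_subset]) (simp add: ball_subset_cball)

text \<open>Induction on the number of moving parameters. Releasing parameter \<open>k\<close> costs
  a Taylor expansion about \<open>q k 0\<close>, whose coefficients are further partial derivatives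
  with only the first \<open>k\<close> parameters moving; hence \<open>js\<close> is arbitrary in
  the induction. The same generality yields the expansion of the derivative in
  \<open>s\<close>.\<close>

lemma iter_pd_has_exp:
  assumes "k \<le> p" "set js \<subseteq> {..<Suc p}"
  shows "has_exp {\<phi>. smooth1 V \<phi>} B (\<lambda>t s. iter_pd js \<alpha> (partial_args q p k t s))"
  using assms
proof (induction k arbitrary: js)
  case 0
  define w where "w = partial_args q p 0 0 0"
  have w: "partial_args q p 0 t s = w(p := s)" for t s
    by (auto simp: w_def partial_args_def fun_eq_iff)
  have "smooth1 V (\<lambda>s. iter_pd js \<alpha> (w(p := s)))"
  proof (rule smooth1I[OF V, where D = "\<lambda>n s. iter_pd (replicate n p @ js) \<alpha> (w(p := s))"])
    fix n s assume "s \<in> V"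
    have js: "set (replicate n p @ js) \<subseteq> {..<Suc p}" using 0 by (auto simp: set_replicate_conv_if)
    have "w(p := s) \<in> U" using \<open>s \<in> V\<close> standard_args_U w by metis
    then show "((\<lambda>s. iter_pd (replicate n p @ js) \<alpha> (w(p := s))) has_real_derivative
                 iter_pd (replicate (Suc n) p @ js) \<alpha> (w(p := s))) (at s)"
      using iter_pd_DERIV[OF smooth js, of p w s] by simp
  qed simp
  then show ?case unfolding w by (intro has_exp_coeff CollectI)
next
  case (Suc k)
  then have k: "k < p" by simp
  let ?c = "q k 0"
  obtain n where n: "0 < n" "littleo (\<lambda>t. (q k t - ?c) ^ n)"
    using Ro_nilpotent[OF q[OF k]] by blast
  have js: "set (replicate m k @ js) \<subseteq> {..<Suc p}" for m using Suc.prems k by (auto split: if_splits)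
  obtain M where M: "\<forall>u\<in>K. \<bar>iter_pd (replicate n k @ js) \<alpha> u\<bar> \<le> M"
    using iter_pd_bounded_on_K[OF js] by blast
  let ?T = "\<lambda>t s. \<Sum>m<n. iter_pd (replicate m k @ js) \<alpha> (partial_args q p k t s) * ((q k t - ?c) ^ m * (1 / fact m))"
  have "has_exp {\<phi>. smooth1 V \<phi>} B ?T"
    using k by (intro has_exp_sum has_exp_mult Suc.IH js Ro_has_exp Ro_mult Ro_power Ro_diff q Ro_const) auto
  moreover have "unif_littleo B (\<lambda>t s. iter_pd js \<alpha> (partial_args q p (Suc k) t s) - ?T t s)"
  proof (rule unif_littleo_mono[OF unif_littleo_const[OF n(2)]])
    show "\<forall>\<^sub>F t in near0. \<forall>s\<in>B. \<bar>iter_pd js \<alpha> (partial_args q p (Suc k) t s) - ?T t s\<bar> \<le> M * \<bar>(q k t - ?c) ^ n\<bar>"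
      using eventually_close
    proof eventually_elim
      case (elim t)
      show ?case
      proof
        fix s assume s: "s \<in> B"
        let ?w = "partial_args q p k t s"
        have w: "?w \<in> K" using partial_args_K[OF s] elim k by simp
        have wK: "?w(k := \<sigma>) \<in> K" if "\<sigma> \<in> {min ?c (q k t)..max ?c (q k t)}" for \<sigma>
        proof -
          have "\<bar>q k t - ?c\<bar> \<le> \<rho>" using elim k by blast
          then have "\<bar>\<sigma> - ?c\<bar> \<le> \<rho>" using that by (auto simp: min_def max_def split: if_splits)
          then show ?thesis using w k by (auto simp: K_iff rk_def)
        qed
        have "\<bar>iter_pd (replicate 0 k @ js) \<alpha> (?w(k := q k t)) -
            (\<Sum>m<n. iter_pd (replicate m k @ js) \<alpha> (?w(k := ?c)) / fact m * (q k t - ?c) ^ m)\<bar> \<le> M * \<bar>q k t - ?c\<bar> ^ n"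
        proof (rule taylor_remainder[OF n(1), where D = "\<lambda>m \<sigma>. iter_pd (replicate m k @ js) \<alpha> (?w(k := \<sigma>))"])
          fix m \<sigma> assume "\<sigma> \<in> {min ?c (q k t)..max ?c (q k t)}"
          then have "?w(k := \<sigma>) \<in> U" using wK K_subset by blast
          then show "((\<lambda>\<sigma>. iter_pd (replicate m k @ js) \<alpha> (?w(k := \<sigma>))) has_real_derivative
              iter_pd (replicate (Suc m) k @ js) \<alpha> (?w(k := \<sigma>))) (at \<sigma>)"
            using iter_pd_DERIV[OF smooth js[of m], of k ?w \<sigma>] k by simp
        qed (use wK M in blast)
        moreover have "?w(k := ?c) = ?w" "?w(k := q k t) = partial_args q p (Suc k) t s"
          using k by (auto simp: partial_args_def fun_eq_iff)
        ultimately show "\<bar>iter_pd js \<alpha> (partial_args q p (Suc k) t s) - ?T t s\<bar> \<le> M * \<bar>(q k t - ?c) ^ n\<bar>"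
          by (simp add: power_abs mult.commute)
      qed
    qed
  qed
  ultimately show ?case by (rule has_exp_perturb)
qed

lemma iter_pd_expansion:
  assumes "set js \<subseteq> {..<Suc p}"
  obtains E \<psi> where "coeffs V E \<psi>"
    "unif_littleo B (\<lambda>t s. iter_pd js \<alpha> (partial_args q p p t s) - (\<Sum>e\<in>E. tpow t e * \<psi> e s))"
  using has_exp_normal_form[OF iter_pd_has_exp[OF order_refl assms]] that by (auto simp: coeffs_def)

end

section \<open>Derivatives of expansions\<close>

lemma coeffs_antiderivative:
  assumes "l < r" "coeffs {l<..<r} E \<psi>"
  obtains \<Psi> where "coeffs {l<..<r} E \<Psi>" "\<And>e s. s \<in> {l<..<r} \<Longrightarrow> (\<Psi> e has_real_derivative \<psi> e s) (at s)"
proof -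
  have sm: "smooth1 {l<..<r} (\<psi> e)" for e using assms by (simp add: coeffs_def)
  have "\<exists>\<Theta>. \<forall>s\<in>{l<..<r}. (\<Theta> has_real_derivative \<psi> e s) (at s)" for e
  proof -
    obtain \<Theta> where "\<forall>x::real. ereal l < x \<longrightarrow> x < ereal r \<longrightarrow> (\<Theta> has_vector_derivative \<psi> e x) (at x)"
      using smooth1_isCont[OF sm, of _ 0] assms(1) einterval_antiderivative[of "ereal l" "ereal r" "\<psi> e"] by auto
    then show ?thesis
      by (intro exI[of _ \<Theta>]) (auto simp: has_real_derivative_iff_has_vector_derivative)
  qed
  then obtain \<Theta> where \<Theta>: "\<And>e s. s \<in> {l<..<r} \<Longrightarrow> (\<Theta> e has_real_derivative \<psi> e s) (at s)"
    by metis
  \<comment> \<open>Outside \<open>E\<close> the coefficient \<open>\<psi> e\<close> is zero, and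
    among its constant primitives the zero one is taken to preserve \<open>coeffs\<close>.\<close>
  define \<Psi> where "\<Psi> e = (if e \<in> E then \<Theta> e else (\<lambda>_. 0))" for e
  have \<Psi>: "(\<Psi> e has_real_derivative \<psi> e s) (at s)" if "s \<in> {l<..<r}" for e s
    using \<Theta>[OF that] assms(2) by (auto simp: \<Psi>_def coeffs_def)
  have "smooth1 {l<..<r} (\<Psi> e)" for e
    using \<Psi> by (rule smooth1_antiderivative[OF open_greaterThanLessThan sm])
  then have "coeffs {l<..<r} E \<Psi>" using assms(2) by (simp add: coeffs_def \<Psi>_def)
  with \<Psi> show ?thesis by (rule that[rotated])
qed

text \<open>Subtracting the antiderivatives of the coefficients of the derivative leaves a function whose
derivative is uniformly \<open>o(t)\<close>; by the mean value theorem so are its increments.\<close>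
lemma expansion_coeff_deriv:
  fixes s0 \<rho> :: real
  defines "B \<equiv> ball s0 \<rho>"
  assumes "\<rho> > 0" and \<psi>: "coeffs B E \<psi>" and \<theta>: "coeffs B E \<theta>"
    and F: "\<forall>\<^sub>F t in near0. \<forall>s\<in>B. (F t has_real_derivative F' t s) (at s)"
    and oF: "unif_littleo B (\<lambda>t s. F t s - (\<Sum>e\<in>E. tpow t e * \<psi> e s))"
    and oF': "unif_littleo B (\<lambda>t s. F' t s - (\<Sum>e\<in>E. tpow t e * \<theta> e s))"
    and s: "s \<in> B"
  shows "deriv (\<psi> e) s = \<theta> e s"
proof -
  have B: "B = {s0 - \<rho><..<s0 + \<rho>}" "open B" "convex B" "s0 \<in> B"
    using \<open>\<rho> > 0\<close> by (auto simp: B_def ball_eq_greaterThanLessThan)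
  obtain \<Theta> where "coeffs B E \<Theta>" and \<Theta>: "\<And>e s. s \<in> B \<Longrightarrow> (\<Theta> e has_real_derivative \<theta> e s) (at s)"
    using coeffs_antiderivative[of "s0 - \<rho>" "s0 + \<rho>" E \<theta>] \<theta> \<open>\<rho> > 0\<close> unfolding B(1) by auto
  define H where "H t r = F t r - (\<Sum>e\<in>E. tpow t e * \<Theta> e r)" for t r
  have H: "littleo (\<lambda>t. H t r - H t s0)" if r: "r \<in> B" for r
    unfolding littleo_iff
  proof (intro allI impI)
    fix \<epsilon> :: real assume "\<epsilon> > 0"
    \<comment> \<open>The bound is divided by \<open>\<rho>\<close> because the increment from
      \<open>s0\<close> to \<open>r\<close> has length at most \<open>\<rho>\<close>.\<close>
    then have "\<forall>\<^sub>F t in near0. \<forall>s\<in>B. \<bar>F' t s - (\<Sum>e\<in>E. tpow t e * \<theta> e s)\<bar> \<le> \<epsilon> / \<rho> * t"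
      using oF' \<open>\<rho> > 0\<close> divide_pos_pos unfolding unif_littleo_def by blast
    with F show "\<forall>\<^sub>F t in near0. \<bar>H t r - H t s0\<bar> \<le> \<epsilon> * t"
    proof eventually_elim
      case (elim t)
      have "(H t has_real_derivative F' t x - (\<Sum>e\<in>E. tpow t e * \<theta> e x)) (at x within B)" if "x \<in> B" for x
      proof -
        have "(H t has_real_derivative F' t x - (\<Sum>e\<in>E. tpow t e * \<theta> e x)) (at x)"
          unfolding H_def using elim(1) that by (intro DERIV_diff DERIV_sum DERIV_cmult \<Theta>) auto
        then show ?thesis by (rule has_field_derivative_at_within)
      qed
      then have "norm (H t r - H t s0) \<le> \<epsilon> / \<rho> * t * norm (r - s0)"
        using elim(2) r B by (intro field_differentiable_bound[of B]) auto
      moreover have "\<epsilon> / \<rho> * t * norm (r - s0) \<le> \<epsilon> / \<rho> * t * \<rho>"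
      proof (rule mult_left_mono)
        show "norm (r - s0) \<le> \<rho>" using r by (auto simp: B_def dist_real_def abs_minus_commute)
        show "0 \<le> \<epsilon> / \<rho> * t" using elim(2) B(4) by (meson abs_ge_zero order_trans)
      qed
      ultimately show ?case using \<open>\<rho> > 0\<close> by simp
    qed
  qed
  \<comment> \<open>Combining the expansion of \<open>F\<close> at \<open>r\<close> and at
    \<open>s0\<close> with the estimate of \<open>H\<close> leaves powers with constant
    coefficients; their uniqueness separates the exponents.\<close>
  have eq: "\<psi> e r = \<Theta> e r + (\<psi> e s0 - \<Theta> e s0)" if r: "r \<in> B" and "e \<in> E" for r e
  proof -
    have o: "littleo (\<lambda>t. F t r - (\<Sum>e\<in>E. tpow t e * \<psi> e r))" if "r \<in> B" for r
      using unif_littleo_curve[OF oF, of "\<lambda>_. r"] that by simp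
    have "littleo (\<lambda>t. (H t r - H t s0) - (F t r - (\<Sum>e\<in>E. tpow t e * \<psi> e r))
        + (F t s0 - (\<Sum>e\<in>E. tpow t e * \<psi> e s0)))"
      by (intro littleo_add littleo_diff[OF H[OF r] o[OF r]] o B(4))
    then have "littleo (\<lambda>t. \<Sum>e\<in>E. tpow t e * ((\<psi> e r - \<psi> e s0) - (\<Theta> e r - \<Theta> e s0)))"
      by (simp add: H_def sum_subtractf sum.distrib algebra_simps)
    then have "\<forall>e\<in>E. (\<psi> e r - \<psi> e s0) - (\<Theta> e r - \<Theta> e s0) = 0"
      using \<psi> by (intro tpow_sum_littleoD) (auto simp: coeffs_def)
    then show ?thesis using \<open>e \<in> E\<close> by force
  qed
  show ?thesis
  proof (cases "e \<in> E")
    case True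
    have "((\<lambda>r. \<Theta> e r + (\<psi> e s0 - \<Theta> e s0)) has_real_derivative \<theta> e s + 0) (at s)"
      by (intro DERIV_add \<Theta> s DERIV_const)
    then have "(\<psi> e has_real_derivative \<theta> e s + 0) (at s)"
      by (rule has_field_derivative_transform_within_open[OF _ B(2) s]) (use eq True in simp)
    then show ?thesis by (simp add: DERIV_imp_deriv)
  qed (use \<psi> \<theta> in \<open>simp add: coeffs_def\<close>)
qed

section \<open>Local and global expansions of smooth functions\<close>

text \<open>The representative of \<open>y\<close> moves inside \<open>B\<close>, so a remainder
  that is \<open>o(t)\<close> only for each fixed \<open>s\<close> would not suffice.\<close>

lemma ext_eq_fex:
  assumes B: "open B" "coeffs B E \<psi>" "st y \<in> B"
    and o: "unif_littleo B (\<lambda>t s. \<beta> (partial_args (\<lambda>i. rep_fermat (q i)) p p t s) - (\<Sum>e\<in>E. tpow t e * \<psi> e s))"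
  shows "ext p \<beta> q y = fex E \<psi> y"
proof -
  let ?f = "\<lambda>t. \<beta> (partial_args (\<lambda>i. rep_fermat (q i)) p p t (rep_fermat y t))"
  have y: "rep_fermat y 0 \<in> B" using B by (simp add: rep_fermat_0)
  have o': "littleo (\<lambda>t. ?f t - (\<Sum>e\<in>E. tpow t e * \<psi> e (rep_fermat y t)))"
    by (rule unif_littleo_curve[OF o Ro_eventually_in_open[OF rep_fermat_Ro B(1) y]])
  have R: "(\<lambda>t. \<Sum>e\<in>E. tpow t e * \<psi> e (rep_fermat y t)) \<in> Ro"
    by (rule expansion_Ro[OF B(1,2) rep_fermat_Ro y])
  have "partial_args (\<lambda>i. rep_fermat (q i)) p p t s =
      (\<lambda>i. if i < p then rep_fermat (q i) t else if i = p then s else 0)" for t s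
    by (auto simp: partial_args_def fun_eq_iff)
  then have "ext p \<beta> q y = abs_fermat ?f" by (simp add: ext_def)
  also have "\<dots> = fex E \<psi> y"
    unfolding fex_def using abs_fermat_eq_iff[OF Ro_perturb[OF R o'] R] o' by blast
  finally show ?thesis .
qed

text \<open>The function and its partial derivative in the last variable are expanded independently;
  \<open>expansion_coeff_deriv\<close> then identifies the second family of coefficients with the
  derivatives of the first. The derivative is thus expressed without \<open>\<alpha>\<close> and
  \<open>q\<close>.\<close>

lemma local_rep_expansion:
  assumes "local_rep S f x p P V \<alpha> q"
  obtains \<rho> E \<psi> where "\<rho> > 0" "coeffs (ball (st x) \<rho>) E \<psi>"
    "\<And>y. y \<in> S \<Longrightarrow> st y \<in> ball (st x) \<rho> \<Longrightarrow> f y = fex E \<psi> y"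
    "ext p (pd p \<alpha>) q x = fex E (\<lambda>e. deriv (\<psi> e)) x"
proof -
  let ?q = "\<lambda>i. rep_fermat (q i)"
  let ?std = "\<lambda>i. if i < p then st (q i) else 0"
  have V: "open V" "st x \<in> V" and P: "open_k p P" "?std \<in> P"
    and sm: "smooth_k (Suc p) (prodset p P V) \<alpha>" and f: "\<And>y. y \<in> S \<Longrightarrow> st y \<in> V \<Longrightarrow> f y = ext p \<alpha> q y"
    using assms by (auto simp: local_rep_def star_k_def)
  obtain d where d: "d > 0" "\<And>v. v \<in> rk p \<Longrightarrow> (\<forall>i<p. \<bar>v i - ?std i\<bar> < d) \<Longrightarrow> v \<in> P"
    using P unfolding open_k_def by meson
  obtain d' where d': "d' > 0" "cball (st x) d' \<subseteq> V" using V open_contains_cball by blast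
  \<comment> \<open>The box is closed while openness of \<open>P\<close> gives a strict bound, hence
    \<open>d / 2\<close>.\<close>
  define \<rho> where "\<rho> = min (d / 2) d'"
  have \<rho>: "\<rho> > 0" "\<rho> < d" "\<rho> \<le> d'" using d d' by (auto simp: \<rho>_def)
  interpret parametrized_smooth p P V \<alpha> "\<lambda>i. rep_fermat (q i)" "st x" \<rho>
  proof
    fix u assume u: "u \<in> rk (Suc p)" "\<And>i. i < p \<Longrightarrow> \<bar>u i - rep_fermat (q i) 0\<bar> \<le> \<rho>" "\<bar>u p - st x\<bar> \<le> \<rho>"
    have "(\<lambda>i. if i < p then u i else 0) \<in> P"
    proof (rule d(2))
      show "\<forall>i<p. \<bar>(if i < p then u i else 0) - ?std i\<bar> < d"
        using u(2) \<rho>(2) by (fastforce simp: rep_fermat_0)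
    qed (simp add: rk_def)
    moreover have "u p \<in> V" using u(3) \<rho>(3) d'(2) by (auto simp: dist_real_def abs_minus_commute)
    ultimately show "u \<in> prodset p P V" using u(1) by (simp add: prodset_def)
  qed (use V sm \<rho> in auto)
  obtain E \<psi> where E: "coeffs V E \<psi>"
    "unif_littleo B (\<lambda>t s. iter_pd [] \<alpha> (partial_args ?q p p t s) - (\<Sum>e\<in>E. tpow t e * \<psi> e s))"
    by (rule iter_pd_expansion[of "[]"]) auto
  obtain E' \<theta> where E': "coeffs V E' \<theta>"
    "unif_littleo B (\<lambda>t s. iter_pd [p] \<alpha> (partial_args ?q p p t s) - (\<Sum>e\<in>E'. tpow t e * \<theta> e s))"
    by (rule iter_pd_expansion[of "[p]"]) auto
  define G where "G = E \<union> E'"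
  have G: "E \<subseteq> G" "E' \<subseteq> G" "finite G" "G \<subseteq> {0..1}" using E E' by (auto simp: G_def coeffs_def)
  have BV: "B \<subseteq> V" using cball_subset by auto
  note \<psi> = coeffs_enlarge[OF coeffs_subset[OF E(1) BV] G(1,3,4)]
  note \<theta> = coeffs_enlarge[OF coeffs_subset[OF E'(1) BV] G(2,3,4)]
  have o: "unif_littleo B (\<lambda>t s. \<alpha> (partial_args ?q p p t s) - (\<Sum>e\<in>G. tpow t e * \<psi> e s))"
    using E(2) by (simp add: \<psi>(2))
  have o': "unif_littleo B (\<lambda>t s. pd p \<alpha> (partial_args ?q p p t s) - (\<Sum>e\<in>G. tpow t e * \<theta> e s))"
    using E'(2) by (simp add: \<theta>(2))
  have F: "\<forall>\<^sub>F t in near0. \<forall>s\<in>B. ((\<lambda>s. \<alpha> (partial_args ?q p p t s)) has_real_derivative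
      pd p \<alpha> (partial_args ?q p p t s)) (at s)"
    using eventually_close
  proof eventually_elim
    case (elim t)
    show ?case
    proof
      fix s assume s: "s \<in> B"
      define w where "w = partial_args ?q p p t 0"
      have w: "partial_args ?q p p t s = w(p := s)" for s
        by (auto simp: w_def partial_args_def fun_eq_iff)
      have "partial_args ?q p p t s \<in> K" using elim s by (intro partial_args_K) auto
      then have "w(p := s) \<in> U" using K_subset w by auto
      then show "((\<lambda>s. \<alpha> (partial_args ?q p p t s)) has_real_derivative
          pd p \<alpha> (partial_args ?q p p t s)) (at s)"
        using iter_pd_DERIV[OF smooth, of "[]" p w s] by (simp add: w)
    qed
  qed
  have "fex G (\<lambda>e. deriv (\<psi> e)) x = fex G \<theta> x"
  proof (rule fex_eq_on_closure[OF _ coeffs_deriv[OF \<psi>(1)] \<theta>(1), where T = B])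
    show "deriv (\<psi> e) s = \<theta> e s" if "s \<in> B" for e s
      by (rule expansion_coeff_deriv[OF \<rho>(1) \<psi>(1) \<theta>(1) F o o' that])
    show "st x \<in> closure B" using \<rho> closure_subset by fastforce
  qed (use \<rho> in auto)
  moreover have "ext p (pd p \<alpha>) q x = fex G \<theta> x"
    using \<rho> by (intro ext_eq_fex[OF _ \<theta>(1) _ o']) auto
  moreover have "f y = fex G \<psi> y" if "y \<in> S" "st y \<in> B" for y
    using f[OF that(1)] that BV ext_eq_fex[OF _ \<psi>(1) that(2) o] by auto
  ultimately show ?thesis using that[OF \<rho>(1) \<psi>(1)] by simp
qed

section \<open>Gluing, and independence of the derivative from the representation\<close>

text \<open>Bisection on \<open>[st a, st b]\<close>: having an expansion is a local property and
  passes to adjacent intervals. The margin \<open>\<epsilon>\<close> makes neighbours overlap and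
  leaves room for representatives that cross the endpoints.\<close>

lemma fsmooth_global_expansion:
  assumes ab: "st a < st b" and f: "fsmooth (fint a b) f"
  obtains \<epsilon> E \<psi> where "\<epsilon> > 0" "coeffs {st a - \<epsilon><..<st b + \<epsilon>} E \<psi>" "\<And>y. y \<in> fint a b \<Longrightarrow> f y = fex E \<psi> y"
proof -
  define P where "P l u \<longleftrightarrow> (st a \<le> l \<and> u \<le> st b \<longrightarrow> (\<exists>\<epsilon>>0. \<exists>E \<psi>. coeffs {l - \<epsilon><..<u + \<epsilon>} E \<psi> \<and>
      (\<forall>y\<in>fint a b. st y \<in> {l - \<epsilon><..<u + \<epsilon>} \<longrightarrow> f y = fex E \<psi> y)))" for l u
  have "P (st a) (st b)"
  proof (rule Bolzano)
    show "st a \<le> st b" using ab by simp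
  next
    fix l m u assume P: "P l m" "P m u" and lm: "l \<le> m" "m \<le> u"
    show "P l u"
    proof (cases "l = m \<or> m = u")
      case True
      then show ?thesis using P by auto
    next
      case False
      then have lmu: "l < m" "m < u" using lm by auto
      show ?thesis unfolding P_def
      proof
        assume lu: "st a \<le> l \<and> u \<le> st b"
        obtain \<epsilon>1 E \<psi> where E: "\<epsilon>1 > 0" "coeffs {l - \<epsilon>1<..<m + \<epsilon>1} E \<psi>"
          "\<And>y. y \<in> fint a b \<Longrightarrow> st y \<in> {l - \<epsilon>1<..<m + \<epsilon>1} \<Longrightarrow> f y = fex E \<psi> y"
          using P(1) lu lmu unfolding P_def by auto
        obtain \<epsilon>2 F \<theta> where F: "\<epsilon>2 > 0" "coeffs {m - \<epsilon>2<..<u + \<epsilon>2} F \<theta>"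
          "\<And>y. y \<in> fint a b \<Longrightarrow> st y \<in> {m - \<epsilon>2<..<u + \<epsilon>2} \<Longrightarrow> f y = fex F \<theta> y"
          using P(2) lu lmu unfolding P_def by auto
        \<comment> \<open>The bounds \<open>m - l\<close> and \<open>u - m\<close> keep the overlap
          around \<open>m\<close> inside \<open>[l, u]\<close>, so its standard points belong to
          \<open>fint a b\<close> and both expansions can be compared there.\<close>
        define \<delta> where "\<delta> = min (min \<epsilon>1 \<epsilon>2) (min (m - l) (u - m))"
        have \<delta>: "\<delta> > 0" "\<delta> \<le> \<epsilon>1" "\<delta> \<le> \<epsilon>2" "\<delta> \<le> m - l" "\<delta> \<le> u - m"
          using E F lmu by (auto simp: \<delta>_def)
        let ?W1 = "{l - \<delta><..<m + \<delta>}" and ?W2 = "{m - \<delta><..<u + \<delta>}"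
        define G where "G = E \<union> F"
        have G: "E \<subseteq> G" "F \<subseteq> G" "finite G" "G \<subseteq> {0..1}" using E F by (auto simp: G_def coeffs_def)
        have W1: "?W1 \<subseteq> {l - \<epsilon>1<..<m + \<epsilon>1}" and W2: "?W2 \<subseteq> {m - \<epsilon>2<..<u + \<epsilon>2}" using \<delta> by auto
        note \<psi> = coeffs_enlarge[OF coeffs_subset[OF E(2) W1] G(1,3,4)]
        note \<theta> = coeffs_enlarge[OF coeffs_subset[OF F(2) W2] G(2,3,4)]
        have eq: "\<psi> e s = \<theta> e s" if s: "s \<in> {m - \<delta><..<m + \<delta>}" for e s
        proof (rule fex_unique[OF _ \<psi>(1) _ _ \<theta>(1)])
          have "fconst s \<in> fint a b" using s lu \<delta> by (intro fconst_fint) auto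
          then show "fex G \<psi> (fconst s) = fex G \<theta> (fconst s)"
            using E(3)[of "fconst s"] F(3)[of "fconst s"] s \<delta> lmu by (simp add: \<psi>(3) \<theta>(3))
        qed (use s lmu in auto)
        \<comment> \<open>The cut at \<open>m\<close> is invisible: by \<open>eq\<close> both
          families agree on a whole neighbourhood of \<open>m\<close>.\<close>
        define \<phi> where "\<phi> e s = (if s < m then \<psi> e s else \<theta> e s)" for e s
        have \<phi>1: "\<phi> e s = \<psi> e s" if "s \<in> ?W1" for e s
          using that eq[of s e] \<delta> by (auto simp: \<phi>_def)
        have \<phi>2: "\<phi> e s = \<theta> e s" if "s \<in> ?W2" for e s
          using that eq[of s e] \<delta> by (auto simp: \<phi>_def)
        have "smooth1 ?W1 (\<phi> e)" "smooth1 ?W2 (\<phi> e)" for e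
          using \<psi>(1) \<theta>(1) \<phi>1 \<phi>2 by (auto simp: coeffs_def intro: smooth1_cong)
        then have "smooth1 (?W1 \<union> ?W2) (\<phi> e)" for e
          by (auto simp: smooth1_def)
        moreover have Un: "?W1 \<union> ?W2 = {l - \<delta><..<u + \<delta>}" using \<delta> lmu by auto
        moreover have "\<phi> e = (\<lambda>_. 0)" if "e \<notin> G" for e
          using that \<psi>(1) \<theta>(1) by (simp add: \<phi>_def coeffs_def fun_eq_iff)
        ultimately have \<phi>: "coeffs {l - \<delta><..<u + \<delta>} G \<phi>" using G by (simp add: coeffs_def)
        have "f y = fex G \<phi> y" if y: "y \<in> fint a b" "st y \<in> {l - \<delta><..<u + \<delta>}" for y
        proof -
          consider "st y \<in> ?W1" | "st y \<in> ?W2" using y(2) unfolding Un[symmetric] by blast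
          then show ?thesis
          proof cases
            case 1
            have "fex G \<phi> y = fex G \<psi> y"
              using 1 \<phi>1 by (intro fex_eq_on_closure[OF _ coeffs_subset[OF \<phi>] \<psi>(1), where T = ?W1] subsetD[OF closure_subset])
                (use \<delta> lmu in auto)
            then show ?thesis using E(3)[OF y(1)] 1 W1 by (auto simp: \<psi>(3))
          next
            case 2
            have "fex G \<phi> y = fex G \<theta> y"
              using 2 \<phi>2 by (intro fex_eq_on_closure[OF _ coeffs_subset[OF \<phi>] \<theta>(1), where T = ?W2] subsetD[OF closure_subset])
                (use \<delta> lmu in auto)
            then show ?thesis using F(3)[OF y(1)] 2 W2 by (auto simp: \<theta>(3))
          qed
        qed
        with \<phi> \<delta>(1) show "\<exists>\<epsilon>>0. \<exists>E \<psi>. coeffs {l - \<epsilon><..<u + \<epsilon>} E \<psi> \<and>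
            (\<forall>y\<in>fint a b. st y \<in> {l - \<epsilon><..<u + \<epsilon>} \<longrightarrow> f y = fex E \<psi> y)"
          by (intro exI[of _ \<delta>] exI[of _ G] exI[of _ \<phi>] conjI ballI impI) simp_all
      qed
    qed
  next
    fix s assume s: "st a \<le> s" "s \<le> st b"
    obtain x where x: "x \<in> fint a b" "st x = s" using fint_st_surj[OF ab, of s] s by auto
    obtain p Q V \<alpha> q where "local_rep (fint a b) f x p Q V \<alpha> q"
      using f x(1) unfolding fsmooth_def by blast
    then obtain \<rho> E \<psi> where E: "\<rho> > 0" "coeffs (ball (st x) \<rho>) E \<psi>"
      "\<And>y. y \<in> fint a b \<Longrightarrow> st y \<in> ball (st x) \<rho> \<Longrightarrow> f y = fex E \<psi> y"
      by (rule local_rep_expansion) blast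
    show "\<exists>d>0. \<forall>l u. l \<le> s \<and> s \<le> u \<and> u - l < d \<longrightarrow> P l u"
    \<comment> \<open>Half of \<open>\<rho>\<close> is for the length of an interval around
      \<open>s\<close>, the other half for its margin.\<close>
    proof (intro exI[of _ "\<rho> / 2"] conjI allI impI)
      fix l u assume lu: "l \<le> s \<and> s \<le> u \<and> u - l < \<rho> / 2"
      have sub: "{l - \<rho> / 2<..<u + \<rho> / 2} \<subseteq> ball (st x) \<rho>"
        using lu x(2) unfolding ball_eq_greaterThanLessThan by auto
      have "f y = fex E \<psi> y" if "y \<in> fint a b" "st y \<in> {l - \<rho> / 2<..<u + \<rho> / 2}" for y
        using E(3)[OF that(1)] subsetD[OF sub that(2)] by blast
      with coeffs_subset[OF E(2) sub] E(1) show "P l u" unfolding P_def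
        by (intro impI exI[of _ "\<rho> / 2"] exI[of _ E] exI[of _ \<psi>] conjI ballI) simp_all
    qed (use E in simp)
  qed
  then obtain \<epsilon> E \<psi> where E: "\<epsilon> > 0" "coeffs {st a - \<epsilon><..<st b + \<epsilon>} E \<psi>"
    "\<And>y. y \<in> fint a b \<Longrightarrow> st y \<in> {st a - \<epsilon><..<st b + \<epsilon>} \<Longrightarrow> f y = fex E \<psi> y"
    unfolding P_def by auto
  have "f y = fex E \<psi> y" if "y \<in> fint a b" for y
    using E(3)[OF that] st_fint[OF that] E(1) by auto
  with E(1,2) show ?thesis by (rule that)
qed

text \<open>Any local representation yields coefficients that agree with \<open>\<Psi>\<close> at
  the nearby standard points of the open interval. The standard part of \<open>x\<close> lies in the
  closure of those points, so the derivatives agree at \<open>x\<close> even at an endpoint, and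
  \<open>SOME\<close> has just one value to choose.\<close>

lemma fderiv_fex:
  assumes ab: "st a < st b" and x: "x \<in> fint a b" and f: "fsmooth (fint a b) f"
    and W: "open W" "coeffs W E \<Psi>" "st x \<in> W"
    and eq: "\<And>y. y \<in> fint a b \<Longrightarrow> st y \<in> W \<Longrightarrow> f y = fex E \<Psi> y"
  shows "fderiv (fint a b) f x = fex E (\<lambda>e. deriv (\<Psi> e)) x"
proof -
  have *: "ext p (pd p \<alpha>) q x = fex E (\<lambda>e. deriv (\<Psi> e)) x" if rep: "local_rep (fint a b) f x p P V \<alpha> q" for p P V \<alpha> q
  proof -
    obtain \<rho> F \<psi> where F: "\<rho> > 0" "coeffs (ball (st x) \<rho>) F \<psi>"
      "\<And>y. y \<in> fint a b \<Longrightarrow> st y \<in> ball (st x) \<rho> \<Longrightarrow> f y = fex F \<psi> y"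
      "ext p (pd p \<alpha>) q x = fex F (\<lambda>e. deriv (\<psi> e)) x"
      using local_rep_expansion[OF rep] by metis
    define W0 where "W0 = W \<inter> ball (st x) \<rho>"
    define G where "G = E \<union> F"
    have G: "E \<subseteq> G" "F \<subseteq> G" "finite G" "G \<subseteq> {0..1}" using W(2) F(2) by (auto simp: G_def coeffs_def)
    have W0: "open W0" "W0 \<subseteq> W" "W0 \<subseteq> ball (st x) \<rho>" "st x \<in> W0" using W F by (auto simp: W0_def)
    note \<Psi> = coeffs_enlarge[OF coeffs_subset[OF W(2) W0(2)] G(1,3,4)]
    note \<psi> = coeffs_enlarge[OF coeffs_subset[OF F(2) W0(3)] G(2,3,4)]
    have "fex G (\<lambda>e. deriv (\<psi> e)) x = fex G (\<lambda>e. deriv (\<Psi> e)) x"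
    proof (rule fex_deriv_eq_on_closure[OF W0(1) \<psi>(1) \<Psi>(1), where T = "W0 \<inter> {st a<..<st b}"])
      fix e s assume s: "s \<in> W0 \<inter> {st a<..<st b}"
      show "\<psi> e s = \<Psi> e s"
      proof (rule fex_unique[OF W0(1) \<psi>(1) _ W0(1) \<Psi>(1)])
        have "fconst s \<in> fint a b" using s by (intro fconst_fint) auto
        moreover have "s \<in> W" "s \<in> ball (st x) \<rho>" using s W0 by blast+
        ultimately show "fex G \<psi> (fconst s) = fex G \<Psi> (fconst s)"
          using F(3)[of "fconst s"] eq[of "fconst s"] by (simp add: \<psi>(3) \<Psi>(3))
      qed (use s in auto)
    next
      have "st x \<in> W0 \<inter> closure {st a<..<st b}" using W0(4) st_fint[OF x] ab by simp
      then show "st x \<in> closure (W0 \<inter> {st a<..<st b})"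
        using open_Int_closure_subset[OF W0(1)] by blast
    qed (use W0 in auto)
    then show ?thesis
      using F(4) coeffs_enlarge(3)[OF coeffs_deriv[OF W(2)] G(1,3,4)] coeffs_enlarge(3)[OF coeffs_deriv[OF F(2)] G(2,3,4)]
      by simp
  qed
  obtain p P V \<alpha> q where rep: "local_rep (fint a b) f x p P V \<alpha> q"
    using f x unfolding fsmooth_def by blast
  show ?thesis unfolding fderiv_def
  proof (rule some_equality)
    show "\<exists>p P V \<alpha> q. local_rep (fint a b) f x p P V \<alpha> q \<and> fex E (\<lambda>e. deriv (\<Psi> e)) x = ext p (pd p \<alpha>) q x"
      using rep *[OF rep] by metis
  qed (use * in metis)
qed

section \<open>Smoothness of expansions\<close>

lemma cont_k_sequentialI:
  assumes "\<And>u X. u \<in> U \<Longrightarrow> (\<And>m. X m \<in> U) \<Longrightarrow> (\<And>i. i < k \<Longrightarrow> (\<lambda>m. X m i) \<longlonglongrightarrow> u i) \<Longrightarrow> (\<lambda>m. g (X m)) \<longlonglongrightarrow> g u"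
  shows "cont_k k U g"
  unfolding cont_k_def
proof (intro ballI allI impI, rule ccontr)
  fix u and e :: real
  assume u: "u \<in> U" and e: "e > 0"
    and neg: "\<not> (\<exists>d>0. \<forall>v\<in>U. (\<forall>i<k. \<bar>v i - u i\<bar> < d) \<longrightarrow> \<bar>g v - g u\<bar> < e)"
  have "\<exists>v. v \<in> U \<and> (\<forall>i<k. \<bar>v i - u i\<bar> < inverse (real (Suc m))) \<and> \<not> \<bar>g v - g u\<bar> < e" for m
    using neg by (meson inverse_positive_iff_positive of_nat_0_less_iff zero_less_Suc)
  then obtain X where X: "\<And>m. X m \<in> U" "\<And>m i. i < k \<Longrightarrow> \<bar>X m i - u i\<bar> < inverse (real (Suc m))"
    "\<And>m. \<not> \<bar>g (X m) - g u\<bar> < e" by metis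
  have "(\<lambda>m. X m i) \<longlonglongrightarrow> u i" if "i < k" for i
  proof (rule LIM_zero_cancel, rule Lim_null_comparison)
    show "\<forall>\<^sub>F m in sequentially. norm (X m i - u i) \<le> inverse (real (Suc m))"
      using X(2)[OF that] by (intro always_eventually allI) (simp add: less_imp_le del: of_nat_Suc)
  qed (rule LIMSEQ_inverse_real_of_nat)
  then have "(\<lambda>m. g (X m)) \<longlonglongrightarrow> g u" using assms u X(1) by blast
  from tendstoD[OF this e] have "\<forall>\<^sub>F m in sequentially. \<bar>g (X m) - g u\<bar> < e" by (simp add: dist_real_def)
  with X(3) show False by simp
qed

text \<open>Model representation of an expansion: the first \<open>n\<close> coordinates stand for
  the powers of \<open>t\<close>, the last one for \<open>s\<close>. The term
  \<open>\<phi> n\<close> closes the class under differentiation in a parameter, which turns a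
  coefficient into a parameter-free term.\<close>

definition param_affine :: "nat \<Rightarrow> (nat \<Rightarrow> real \<Rightarrow> real) \<Rightarrow> (nat \<Rightarrow> real) \<Rightarrow> real" where
  "param_affine n \<phi> u = (\<Sum>i<n. u i * \<phi> i (u n)) + \<phi> n (u n)"

lemma param_affine_DERIV:
  assumes \<phi>: "\<And>i. smooth1 W (\<phi> i)" and "u n \<in> W" and "j < Suc n"
  shows "((\<lambda>s. param_affine n \<phi> (u(j := s))) has_real_derivative
     param_affine n (if j < n then (\<lambda>i. if i = n then \<phi> j else (\<lambda>_. 0)) else (\<lambda>i. deriv (\<phi> i))) u) (at (u j))"
proof (cases "j < n")
  case True
  have "((\<lambda>s. (\<Sum>i<n. (if i = j then s else u i) * \<phi> i (u n)) + \<phi> n (u n)) has_real_derivative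
      (\<Sum>i<n. (if i = j then 1 else 0) * \<phi> i (u n)) + 0) (at (u j))"
    by (intro DERIV_add DERIV_sum DERIV_cmult_right DERIV_const) auto
  also have "(\<Sum>i<n. (if i = j then 1 else 0) * \<phi> i (u n)) + 0 = \<phi> j (u n)"
    using True by (simp add: if_distrib[of "\<lambda>x. x * _"] cong: if_cong)
  finally show ?thesis using True by (simp add: param_affine_def)
next
  case False
  then have j: "j = n" using assms by simp
  have "((\<lambda>s. (\<Sum>i<n. u i * \<phi> i s) + \<phi> n s) has_real_derivative
      (\<Sum>i<n. u i * deriv (\<phi> i) (u n)) + deriv (\<phi> n) (u n)) (at (u n))"
    by (intro DERIV_add DERIV_sum DERIV_cmult smooth1_DERIV0[OF \<phi>] assms(2))
  then show ?thesis by (simp add: param_affine_def j)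
qed

text \<open>The class is stable under every partial derivative, so continuity and differentiability
  need to be checked only once. Equalities hold only on the domain; \<open>nhd\<close> makes them
  hold near the point where \<open>deriv\<close> is taken.\<close>

lemma smooth_k_param_affine:
  assumes W: "open W" and \<phi>: "\<And>i. smooth1 W (\<phi> i)"
  shows "smooth_k (Suc n) (prodset n (rk n) W) (param_affine n \<phi>)"
proof -
  let ?U = "prodset n (rk n) W"
  have U: "u \<in> ?U \<longleftrightarrow> u \<in> rk (Suc n) \<and> u n \<in> W" for u
    by (auto simp: prodset_def rk_def)
  have nhd: "\<forall>\<^sub>F s in nhds (u j). u(j := s) \<in> ?U" if u: "u \<in> ?U" and j: "j < Suc n" for u j
  proof -
    have rk: "u(j := s) \<in> rk (Suc n)" for s
      using u[unfolded U] j by (auto simp: rk_def)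
    show ?thesis
    proof (cases "j = n")
      case True
      have "\<forall>\<^sub>F s in nhds (u n). s \<in> W" using u by (intro eventually_nhds_in_open W) (simp add: U)
      then show ?thesis using rk True by (simp add: U)
    next
      case False
      then show ?thesis using u rk by (simp add: U)
    qed
  qed
  have iter: "\<exists>\<psi>. (\<forall>i. smooth1 W (\<psi> i)) \<and> (\<forall>u\<in>?U. iter_pd js (param_affine n \<phi>) u = param_affine n \<psi> u)"
    if "set js \<subseteq> {..<Suc n}" for js
    using that
  proof (induction js)
    case Nil
    then show ?case using \<phi> by auto
  next
    case (Cons j js)
    then obtain \<psi> where \<psi>: "\<And>i. smooth1 W (\<psi> i)"
      "\<And>u. u \<in> ?U \<Longrightarrow> iter_pd js (param_affine n \<phi>) u = param_affine n \<psi> u" by auto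
    let ?\<theta> = "if j < n then (\<lambda>i. if i = n then \<psi> j else (\<lambda>_. 0)) else (\<lambda>i. deriv (\<psi> i))"
    have "iter_pd (j # js) (param_affine n \<phi>) u = param_affine n ?\<theta> u" if u: "u \<in> ?U" for u
    proof -
      have "deriv (\<lambda>s. iter_pd js (param_affine n \<phi>) (u(j := s))) (u j) = deriv (\<lambda>s. param_affine n \<psi> (u(j := s))) (u j)"
        using nhd[OF u, of j] Cons.prems by (intro deriv_cong_ev) (auto elim!: eventually_mono simp: \<psi>(2))
      also have "\<dots> = param_affine n ?\<theta> u"
        using u Cons.prems by (intro DERIV_imp_deriv param_affine_DERIV[OF \<psi>(1)]) (auto simp: U)
      finally show ?thesis by (simp add: pd_def)
    qed
    moreover have "smooth1 W (?\<theta> i)" for i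
      using \<psi>(1) smooth1_deriv smooth1_const[OF W] by simp
    ultimately show ?case by (intro exI[of _ ?\<theta>]) blast
  qed
  have reg: "cont_k (Suc n) ?U g \<and> (\<forall>j<Suc n. \<forall>u\<in>?U. (\<lambda>s. g (u(j := s))) differentiable (at (u j)))"
    if \<psi>: "\<And>i. smooth1 W (\<psi> i)" and g: "\<And>u. u \<in> ?U \<Longrightarrow> g u = param_affine n \<psi> u" for g \<psi>
  proof (intro conjI allI impI ballI)
    show "cont_k (Suc n) ?U g"
    proof (rule cont_k_sequentialI)
      fix u X assume u: "u \<in> ?U" and X: "\<And>m. X m \<in> ?U" "\<And>i. i < Suc n \<Longrightarrow> (\<lambda>m. X m i) \<longlonglongrightarrow> u i"
      have "(\<lambda>m. \<psi> i (X m n)) \<longlonglongrightarrow> \<psi> i (u n)" for i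
        using smooth1_isCont[OF \<psi>, of "u n" 0 i] u[unfolded U] by (intro isCont_tendsto_compose[OF _ X(2)]) simp_all
      then have "(\<lambda>m. param_affine n \<psi> (X m)) \<longlonglongrightarrow> param_affine n \<psi> u"
        unfolding param_affine_def using X(2) by (intro tendsto_intros) auto
      then show "(\<lambda>m. g (X m)) \<longlonglongrightarrow> g u" using g u X(1) by simp
    qed
    fix j u assume j: "j < Suc n" and u: "u \<in> ?U"
    have d: "((\<lambda>s. param_affine n \<psi> (u(j := s))) has_real_derivative
       param_affine n (if j < n then (\<lambda>i. if i = n then \<psi> j else (\<lambda>_. 0)) else (\<lambda>i. deriv (\<psi> i))) u) (at (u j))"
      using u j by (intro param_affine_DERIV[OF \<psi>]) (auto simp: U)
    have ev: "\<forall>\<^sub>F s in nhds (u j). param_affine n \<psi> (u(j := s)) = g (u(j := s))"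
      using nhd[OF u j] by (rule eventually_mono) (simp add: g)
    show "(\<lambda>s. g (u(j := s))) differentiable (at (u j))"
      unfolding real_differentiable_def using iffD1[OF DERIV_cong_ev[OF refl ev refl] d] by (rule exI)
  qed
  show ?thesis unfolding smooth_k_def
  proof (intro allI impI)
    fix js assume "set js \<subseteq> {..<Suc n}"
    then obtain \<psi> where "\<And>i. smooth1 W (\<psi> i)" "\<And>u. u \<in> ?U \<Longrightarrow> iter_pd js (param_affine n \<phi>) u = param_affine n \<psi> u"
      using iter by metis
    then show "cont_k (Suc n) ?U (iter_pd js (param_affine n \<phi>)) \<and>
        (\<forall>j<Suc n. \<forall>u\<in>?U. (\<lambda>s. iter_pd js (param_affine n \<phi>) (u(j := s))) differentiable (at (u j)))"
      by (rule reg)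
  qed
qed

lemma fsmooth_fex:
  assumes W: "open W" "coeffs W E \<Psi>" and S: "\<And>x. x \<in> S \<Longrightarrow> st x \<in> W"
  shows "fsmooth S (fex E \<Psi>)"
  unfolding fsmooth_def
proof
  fix x assume x: "x \<in> S"
  have E: "finite E" "E \<subseteq> {0..1}" using W by (auto simp: coeffs_def)
  define n where "n = card E"
  obtain h where h: "bij_betw h {..<n} E"
    using ex_bij_betw_nat_finite[OF E(1)] by (auto simp: n_def atLeast0LessThan)
  have h0: "0 \<le> h i" if "i < n" for i using h E that by (fastforce simp: bij_betw_def)
  define \<phi> where "\<phi> i = (if i < n then \<Psi> (h i) else (\<lambda>_. 0))" for i
  \<comment> \<open>The powers of \<open>t\<close> become the parameters of a single representation
    valid around every point. Their chosen representatives differ from the powers by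
    \<open>o(t)\<close>, which bounded coefficients absorb.\<close>
  define q where "q i = abs_fermat (\<lambda>t. tpow t (h i))" for i
  have sm: "smooth1 W (\<phi> i)" for i
    using W smooth1_const[OF W(1)] by (simp add: \<phi>_def coeffs_def)
  have "fex E \<Psi> y = ext n (param_affine n \<phi>) q y" if y: "st y \<in> W" for y
  proof -
    have y0: "rep_fermat y 0 \<in> W" using y by (simp add: rep_fermat_0)
    have "littleo (\<lambda>t. \<Sum>i<n. (rep_fermat (q i) t - tpow t (h i)) * \<Psi> (h i) (rep_fermat y t))"
    proof (rule littleo_sum)
      fix i assume "i \<in> {..<n}"
      then have "littleo (\<lambda>t. rep_fermat (q i) t - tpow t (h i))"
        unfolding q_def by (intro rep_abs_fermat Ro_tpow h0) simp
      moreover have "smooth1 W (\<Psi> (h i))" using W by (simp add: coeffs_def)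
      from Ro_bounded[OF smooth1_Ro[OF W(1) this rep_fermat_Ro y0]]
      have "unif_bounded (UNIV :: unit set) (\<lambda>t _. \<Psi> (h i) (rep_fermat y t))" .
      ultimately show "littleo (\<lambda>t. (rep_fermat (q i) t - tpow t (h i)) * \<Psi> (h i) (rep_fermat y t))"
        by (rule littleo_mult)
    qed
    moreover have "(\<Sum>e\<in>E. tpow t e * \<Psi> e s) = (\<Sum>i<n. tpow t (h i) * \<Psi> (h i) s)" for t s
      using sum.reindex_bij_betw[OF h, of "\<lambda>e. tpow t e * \<Psi> e s"] by simp
    ultimately have o: "littleo (\<lambda>t. (\<Sum>i<n. rep_fermat (q i) t * \<Psi> (h i) (rep_fermat y t)) -
        (\<Sum>e\<in>E. tpow t e * \<Psi> e (rep_fermat y t)))"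
      by (simp add: sum_subtractf left_diff_distrib)
    have R: "(\<lambda>t. \<Sum>e\<in>E. tpow t e * \<Psi> e (rep_fermat y t)) \<in> Ro"
      by (rule expansion_Ro[OF W rep_fermat_Ro y0])
    have "abs_fermat (\<lambda>t. \<Sum>i<n. rep_fermat (q i) t * \<Psi> (h i) (rep_fermat y t)) = fex E \<Psi> y"
      unfolding fex_def using abs_fermat_eq_iff[OF Ro_perturb[OF R o] R] o by blast
    then show ?thesis
      by (simp add: ext_def param_affine_def \<phi>_def)
  qed
  moreover have "open_k n (rk n)" by (auto simp: open_k_def intro: exI[of _ 1])
  moreover have "q \<in> star_k n (rk n)" by (simp add: star_k_def rk_def)
  ultimately have "local_rep S (fex E \<Psi>) x n (rk n) W (param_affine n \<phi>) q"
    using W(1) S[OF x] smooth_k_param_affine[OF W(1) sm] by (simp add: local_rep_def)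
  then show "\<exists>p P V \<alpha> q. local_rep S (fex E \<Psi>) x p P V \<alpha> q" by blast
qed

section \<open>Existence and uniqueness of the primitive\<close>

theorem theorem12:
  fixes a b u :: fermat and f :: "fermat \<Rightarrow> fermat"
  assumes "st a < st b"
    and "fsmooth (fint a b) f"
    and "u \<in> fint a b"
  shows "\<exists>I. fsmooth (fint a b) I \<and> (\<forall>x\<in>fint a b. fderiv (fint a b) I x = f x) \<and> I u = fconst 0
           \<and> (\<forall>J. fsmooth (fint a b) J \<and> (\<forall>x\<in>fint a b. fderiv (fint a b) J x = f x) \<and> J u = fconst 0
                  \<longrightarrow> (\<forall>x\<in>fint a b. J x = I x))"
proof -
  let ?S = "fint a b"
  obtain \<epsilon> E \<psi> where \<epsilon>: "\<epsilon> > 0" and \<psi>: "coeffs {st a - \<epsilon><..<st b + \<epsilon>} E \<psi>"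
    and f: "\<And>y. y \<in> ?S \<Longrightarrow> f y = fex E \<psi> y"
    using fsmooth_global_expansion[OF assms(1,2)] by metis
  define W where "W = {st a - \<epsilon><..<st b + \<epsilon>}"
  note \<psi> = \<psi>[folded W_def]
  have W: "open W" and SW: "\<And>x. x \<in> ?S \<Longrightarrow> st x \<in> W"
    using st_fint \<epsilon> by (fastforce simp: W_def)+
  have W_closure: "st x \<in> closure {st a<..<st b}" if "x \<in> ?S" for x
    using st_fint[OF that] assms(1) by simp
  obtain \<Psi> where \<Psi>: "coeffs W E \<Psi>" "\<And>e s. s \<in> W \<Longrightarrow> (\<Psi> e has_real_derivative \<psi> e s) (at s)"
    using coeffs_antiderivative[of "st a - \<epsilon>" "st b + \<epsilon>" E \<psi>] \<psi> \<epsilon> assms(1) unfolding W_def by auto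
  have u0: "rep_fermat u 0 \<in> W" using SW[OF assms(3)] by (simp add: rep_fermat_0)
  \<comment> \<open>The raw primitive has a Fermat real as its value at \<open>u\<close>. The real
    coefficients of that value are subtracted exponent by exponent, which leaves all derivatives
    unchanged; its exponents may lie outside \<open>E\<close>, hence the enlargement to
    \<open>G\<close>.\<close>
  obtain E' c where E': "finite E'" "E' \<subseteq> {0..1}" "\<And>e. e \<notin> E' \<Longrightarrow> c e = 0"
    and c: "littleo (\<lambda>t. (\<Sum>e\<in>E. tpow t e * \<Psi> e (rep_fermat u t)) - (\<Sum>e\<in>E'. tpow t e * c e))"
    using Ro_expansion[OF expansion_Ro[OF W \<Psi>(1) rep_fermat_Ro u0]] by blast
  define G where "G = E \<union> E'"
  have G: "E \<subseteq> G" "E' \<subseteq> G" "finite G" "G \<subseteq> {0..1}" using \<psi> E' by (auto simp: G_def coeffs_def)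
  define \<Phi> where "\<Phi> e s = \<Psi> e s - c e" for e s
  have \<Phi>: "coeffs W G \<Phi>"
    unfolding coeffs_def
  proof (intro conjI allI impI)
    show "smooth1 W (\<Phi> e)" for e
      unfolding \<Phi>_def using \<Psi>(1) by (intro smooth1_diff smooth1_const W) (simp add: coeffs_def)
    show "\<Phi> e = (\<lambda>_. 0)" if "e \<notin> G" for e
    proof -
      have "e \<notin> E" "e \<notin> E'" using that G by auto
      then show ?thesis using \<Psi>(1) E'(3) by (simp add: \<Phi>_def coeffs_def fun_eq_iff)
    qed
  qed (use G in auto)
  have deriv_\<Phi>: "(\<Phi> e has_real_derivative \<psi> e s) (at s)" if "s \<in> W" for e s
    unfolding \<Phi>_def using DERIV_diff[OF \<Psi>(2)[OF that, of e] DERIV_const[of "c e"]] by simp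
  define I where "I = fex G \<Phi>"
  have smooth_I: "fsmooth ?S I"
    unfolding I_def by (rule fsmooth_fex[OF W \<Phi> SW])
  have "fderiv ?S I x = f x" if x: "x \<in> ?S" for x
  proof -
    have "fderiv ?S I x = fex G (\<lambda>e. deriv (\<Phi> e)) x"
      by (rule fderiv_fex[OF assms(1) x smooth_I W \<Phi> SW[OF x]]) (simp add: I_def)
    also have "\<dots> = fex G \<psi> x"
      by (rule fex_eq_on_closure[OF W coeffs_deriv[OF \<Phi>] coeffs_enlarge(1)[OF \<psi> G(1,3,4)] W order_refl])
        (use deriv_\<Phi> SW[OF x] closure_subset in \<open>auto intro: DERIV_imp_deriv\<close>)
    finally show ?thesis by (simp add: f[OF x] coeffs_enlarge(3)[OF \<psi> G(1,3,4)])
  qed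
  moreover have I_u: "I u = fconst 0"
  proof -
    have "(\<Sum>e\<in>E'. tpow t e * c e) = (\<Sum>e\<in>G. tpow t e * c e)" for t
      using G E' by (intro sum.mono_neutral_left) auto
    with c have "littleo (\<lambda>t. (\<Sum>e\<in>G. tpow t e * \<Phi> e (rep_fermat u t)) - 0)"
      by (simp add: \<Phi>_def right_diff_distrib sum_subtractf coeffs_enlarge(2)[OF \<Psi>(1) G(1,3,4)])
    then show ?thesis
      unfolding I_def fex_def fconst_def
      using abs_fermat_eq_iff[OF expansion_Ro[OF W \<Phi> rep_fermat_Ro u0] Ro_const] by blast
  qed
  moreover have "J x = I x"
    if J: "fsmooth ?S J" "\<And>x. x \<in> ?S \<Longrightarrow> fderiv ?S J x = f x" "J u = fconst 0" and x: "x \<in> ?S" for J x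
  proof -
    obtain \<delta> F \<theta> where \<delta>: "\<delta> > 0" and \<theta>: "coeffs {st a - \<delta><..<st b + \<delta>} F \<theta>"
      and J_eq: "\<And>y. y \<in> ?S \<Longrightarrow> J y = fex F \<theta> y"
      using fsmooth_global_expansion[OF assms(1) J(1)] by metis
    define W' where "W' = W \<inter> {st a - \<delta><..<st b + \<delta>}"
    define H where "H = G \<union> F"
    have H: "G \<subseteq> H" "F \<subseteq> H" "E \<subseteq> H" "finite H" "H \<subseteq> {0..1}" using G \<theta> by (auto simp: H_def coeffs_def)
    have W': "open W'" "W' \<subseteq> W" "W' \<subseteq> {st a - \<delta><..<st b + \<delta>}" and SW': "\<And>x. x \<in> ?S \<Longrightarrow> st x \<in> W'"
      using W SW st_fint \<delta> by (fastforce simp: W'_def)+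
    have T: "{st a<..<st b} \<subseteq> W'" using \<epsilon> \<delta> by (auto simp: W'_def W_def)
    note \<theta>H = coeffs_enlarge[OF coeffs_subset[OF \<theta> W'(3)] H(2,4,5)]
    note \<Phi>H = coeffs_enlarge[OF coeffs_subset[OF \<Phi> W'(2)] H(1,4,5)]
    note \<psi>H = coeffs_enlarge[OF coeffs_subset[OF \<psi> W'(2)] H(3,4,5)]
    \<comment> \<open>Evaluating \<open>fderiv\<close> at standard points turns an identity between
      Fermat reals into one real differential equation per exponent.\<close>
    have deriv_\<theta>: "deriv (\<theta> e) s = \<psi> e s" if s: "s \<in> {st a<..<st b}" for e s
    proof (rule fex_unique[OF W'(1) coeffs_deriv[OF \<theta>H(1)] _ W'(1) \<psi>H(1)])
      have fs: "fconst s \<in> ?S" using s by (rule fconst_fint)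
      have "fderiv ?S J (fconst s) = fex H (\<lambda>e. deriv (\<theta> e)) (fconst s)"
        by (rule fderiv_fex[OF assms(1) fs J(1) W'(1) \<theta>H(1) SW'[OF fs]]) (simp add: J_eq \<theta>H(3))
      then show "fex H (\<lambda>e. deriv (\<theta> e)) (fconst s) = fex H \<psi> (fconst s)"
        using J(2)[OF fs] f[OF fs] by (simp add: \<psi>H(3))
    qed (use s T in auto)
    have "\<exists>k. \<forall>s\<in>{st a<..<st b}. \<theta> e s - \<Phi> e s = k" for e
    proof (rule has_field_derivative_zero_constant)
      fix s assume s: "s \<in> {st a<..<st b}"
      then have "(\<theta> e has_real_derivative \<psi> e s) (at s)"
        using smooth1_DERIV0[of W' "\<theta> e" s] \<theta>H(1) T deriv_\<theta>[OF s] by (auto simp: coeffs_def)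
      moreover have "(\<Phi> e has_real_derivative \<psi> e s) (at s)" using s T W'(2) by (intro deriv_\<Phi>) auto
      ultimately have "((\<lambda>s. \<theta> e s - \<Phi> e s) has_real_derivative \<psi> e s - \<psi> e s) (at s)"
        by (rule DERIV_diff)
      then show "((\<lambda>s. \<theta> e s - \<Phi> e s) has_real_derivative 0) (at s within {st a<..<st b})"
        by (simp add: has_field_derivative_at_within)
    qed simp
    then obtain k where k: "\<And>e s. s \<in> {st a<..<st b} \<Longrightarrow> \<theta> e s - \<Phi> e s = k e" by metis
    \<comment> \<open>A sample point at which \<open>k e = 0\<close> is read off for
      \<open>e\<close> outside \<open>H\<close>.\<close>
    define m where "m = (st a + st b) / 2"
    have m: "m \<in> {st a<..<st b}" using assms(1) by (simp add: m_def)
    have \<Phi>k: "coeffs W' H (\<lambda>e s. \<Phi> e s + k e)"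
      unfolding coeffs_def
    proof (intro conjI allI impI)
      show "smooth1 W' (\<lambda>s. \<Phi> e s + k e)" for e
        using \<Phi>H(1) by (intro smooth1_add smooth1_const W'(1)) (simp add: coeffs_def)
      show "(\<lambda>s. \<Phi> e s + k e) = (\<lambda>_. 0)" if "e \<notin> H" for e
        using that \<Phi>H(1) \<theta>H(1) k[OF m, of e] by (simp add: coeffs_def)
    qed (use H in auto)
    have J_\<Phi>: "J y = fex H (\<lambda>e s. \<Phi> e s + k e) y" if y: "y \<in> ?S" for y
    proof -
      have "fex H \<theta> y = fex H (\<lambda>e s. \<Phi> e s + k e) y"
        by (rule fex_eq_on_closure[OF W'(1) \<theta>H(1) \<Phi>k open_greaterThanLessThan T _ SW'[OF y] W_closure[OF y]])
          (simp add: k[symmetric])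
      then show ?thesis by (simp add: J_eq[OF y] \<theta>H(3))
    qed
    have u0': "rep_fermat u 0 \<in> W'" using SW'[OF assms(3)] by (simp add: rep_fermat_0)
    \<comment> \<open>The single condition at \<open>u\<close> fixes all constants
      \<open>k e\<close> simultaneously, since the powers of \<open>t\<close> are independent modulo
      \<open>o(t)\<close>.\<close>
    have "fex H (\<lambda>e s. \<Phi> e s + k e) u = fex H \<Phi> u"
      using J_\<Phi>[OF assms(3)] J(3) I_u by (simp add: I_def \<Phi>H(3))
    then have "littleo (\<lambda>t. (\<Sum>e\<in>H. tpow t e * (\<Phi> e (rep_fermat u t) + k e)) - (\<Sum>e\<in>H. tpow t e * \<Phi> e (rep_fermat u t)))"
      unfolding fex_def
      using abs_fermat_eq_iff[OF expansion_Ro[OF W'(1) \<Phi>k rep_fermat_Ro u0'] expansion_Ro[OF W'(1) \<Phi>H(1) rep_fermat_Ro u0']]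
      by blast
    then have "littleo (\<lambda>t. \<Sum>e\<in>H. tpow t e * k e)"
      by (simp add: distrib_left sum.distrib)
    then have "\<forall>e\<in>H. k e = 0" by (rule tpow_sum_littleoD[OF H(4,5)])
    then have "fex H (\<lambda>e s. \<Phi> e s + k e) x = fex H \<Phi> x" by (simp add: fex_def)
    then show ?thesis using J_\<Phi>[OF x] by (simp add: I_def \<Phi>H(3))
  qed
  ultimately show ?thesis using smooth_I by (intro exI[of _ I]) blast
qed

end
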